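(* An invertible unital linear map $\phi:M_n(\mathbb{C})\to M_n(\mathbb{C})$ is $q$-pure if and only if there are a unitary $U\in M_n(\mathbb{C})$ and real numbers $\lambda_1,\ldots,\lambda_n$ with $\lambda_1+\cdots+\lambda_n=0$ such that the map $\phi_U(A)=U^*\phi(UAU^* )U$ is the Schur map $$\phi_U(a_{jk}e_{jk})=\frac{a_{jk}}{1+i(\lambda_j-\lambda_k)}\,e_{jk}$$ for all $A=(a_{jk})\in M_n(\mathbb{C})$ and all $j,k=1,\ldots,n$.
   Context: $\{e_{jk}\}$ are the standard matrix units of $M_n(\mathbb{C})$. For linear maps, $I$ denotes the identity map. A linear map $\phi:M_n(\mathbb{C})\to M_n(\mathbb{C})$ is $q$-positive if it has no negative eigenvalues and $\phi(I+t\phi)^{-1}$ is completely positive for all $t\ge0$. For $q$-positive $\phi,\psi$ on $M_n(\mathbb{C})$, $\psi$ is a $q$-subordinate of $\phi$ if $\phi(I+t\phi)^{-1}-\psi(I+t\psi)^{-1}$ is completely positive for all $t\ge0$. For $s\ge0$ let $\phi^{(s)}=\phi(I+s\phi)^{-1}$. A unital linear map $\phi$ is $q$-pure if it is $q$-positive and its set of $q$-subordinates is precisely $\{0\}\cup\{\phi^{(s)}\}_{s\ge0}$. *)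

theory Defs
  imports "HOL-Analysis.Analysis"
begin

text \<open>
  Square complex matrices are elements of \<open>complex^'n^'n\<close>; the index type \<open>'n\<close> is finite and
  nonempty, so \<open>n = CARD('n) \<ge> 1\<close>.  The library function \<open>linear\<close> only expresses real linearity,
  so complex linearity is stated through \<open>Vector_Spaces.linear\<close> with the complex scaling
  of matrices.
\<close>

definition mscale :: "complex \<Rightarrow> complex^'n^'m \<Rightarrow> complex^'n^'m"
  where "mscale c = map_matrix ((*) c)"

lemma vector_space_mscale: "vector_space (mscale :: complex \<Rightarrow> complex^'n^'m \<Rightarrow> complex^'n^'m)"
  by unfold_locales (simp_all add: mscale_def map_matrix_def vec_eq_iff algebra_simps)

lemma mscale_of_real: "mscale (of_real t) A = t *\<^sub>R A"
  by (simp add: mscale_def map_matrix_def vec_eq_iff scaleR_conv_of_real[where 'a = complex])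

definition clinear_map :: "(complex^'n^'n \<Rightarrow> complex^'n^'n) \<Rightarrow> bool"
  where "clinear_map = Vector_Spaces.linear mscale mscale"

definition conj_transpose :: "complex^'n^'m \<Rightarrow> complex^'m^'n"
  where "conj_transpose A = transpose (map_matrix cnj A)"

definition unitary :: "complex^'n^'n \<Rightarrow> bool"
  where "unitary U \<longleftrightarrow> conj_transpose U ** U = mat 1 \<and> U ** conj_transpose U = mat 1"

definition matrix_unit :: "'n \<Rightarrow> 'n \<Rightarrow> complex^'n^'n"
  where "matrix_unit j k = (\<chi> p q. if p = j \<and> q = k then 1 else 0)"

definition cinner_vec :: "complex^'n \<Rightarrow> complex^'n \<Rightarrow> complex"
  where "cinner_vec x y = (\<Sum>p\<in>UNIV. cnj (x $ p) * y $ p)"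

text \<open>
  An \<open>m \<times> m\<close> matrix \<open>(A i j)\<close>, \<open>i, j < m\<close>, of \<open>n \<times> n\<close> blocks is an element of the matrix algebra
  over \<open>M\<^sub>n(\<complex>)\<close>, acting on \<open>m\<close>-tuples of vectors in \<open>\<complex>\<^sup>n\<close>; blocks with other indices are ignored.
  Positivity includes that the quadratic form is real valued.
\<close>

definition block_positive :: "nat \<Rightarrow> (nat \<Rightarrow> nat \<Rightarrow> complex^'n^'n) \<Rightarrow> bool"
  where "block_positive m A \<longleftrightarrow>
    (\<forall>x :: nat \<Rightarrow> complex^'n. (\<Sum>i<m. \<Sum>j<m. cinner_vec (x i) (A i j *v x j)) \<in> \<real>\<^sub>\<ge>\<^sub>0)"

definition completely_positive :: "(complex^'n^'n \<Rightarrow> complex^'n^'n) \<Rightarrow> bool"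
  where "completely_positive \<phi> \<longleftrightarrow> clinear_map \<phi> \<and>
    (\<forall>m A. block_positive m A \<longrightarrow> block_positive m (\<lambda>i j. \<phi> (A i j)))"

definition is_eigenvalue :: "(complex^'n^'n \<Rightarrow> complex^'n^'n) \<Rightarrow> complex \<Rightarrow> bool"
  where "is_eigenvalue \<phi> c \<longleftrightarrow> (\<exists>A. A \<noteq> 0 \<and> \<phi> A = mscale c A)"

text \<open>
  The map \<open>\<phi>\<^sup>(\<^sup>t\<^sup>) = \<phi>(I + t\<phi>)\<^sup>-\<^sup>1\<close>.  When \<open>\<phi>\<close> is linear without negative eigenvalues and \<open>t \<ge> 0\<close>,
  \<open>I + t\<phi>\<close> is bijective and \<open>inv\<close> is its two-sided inverse; outside this case the value is
  immaterial.
\<close>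

definition resolvent :: "real \<Rightarrow> (complex^'n^'n \<Rightarrow> complex^'n^'n) \<Rightarrow> complex^'n^'n \<Rightarrow> complex^'n^'n"
  where "resolvent t \<phi> = \<phi> \<circ> inv (\<lambda>A. A + t *\<^sub>R \<phi> A)"

definition q_positive :: "(complex^'n^'n \<Rightarrow> complex^'n^'n) \<Rightarrow> bool"
  where "q_positive \<phi> \<longleftrightarrow> clinear_map \<phi> \<and>
    (\<forall>r<0. \<not> is_eigenvalue \<phi> (of_real r)) \<and>
    (\<forall>t\<ge>0. completely_positive (resolvent t \<phi>))"

definition q_subordinate ::
    "(complex^'n^'n \<Rightarrow> complex^'n^'n) \<Rightarrow> (complex^'n^'n \<Rightarrow> complex^'n^'n) \<Rightarrow> bool"
  where "q_subordinate \<psi> \<phi> \<longleftrightarrow> q_positive \<psi> \<and> q_positive \<phi> \<and>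
    (\<forall>t\<ge>0. completely_positive (\<lambda>A. resolvent t \<phi> A - resolvent t \<psi> A))"

definition unital :: "(complex^'n^'n \<Rightarrow> complex^'n^'n) \<Rightarrow> bool"
  where "unital \<phi> \<longleftrightarrow> \<phi> (mat 1) = mat 1"

definition q_pure :: "(complex^'n^'n \<Rightarrow> complex^'n^'n) \<Rightarrow> bool"
  where "q_pure \<phi> \<longleftrightarrow> unital \<phi> \<and> q_positive \<phi> \<and>
    {\<psi>. q_subordinate \<psi> \<phi>} = {\<lambda>_. 0} \<union> {resolvent s \<phi> | s. s \<ge> 0}"

definition unitary_conjugate ::
    "complex^'n^'n \<Rightarrow> (complex^'n^'n \<Rightarrow> complex^'n^'n) \<Rightarrow> complex^'n^'n \<Rightarrow> complex^'n^'n"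
  where "unitary_conjugate U \<phi> A = conj_transpose U ** \<phi> (U ** A ** conj_transpose U) ** U"

end

theory Submission
  imports Defs
begin

text \<open>
  Write \<open>\<psi> = \<phi>\<^sup>-\<^sup>1\<close>.  The resolvents of \<open>\<phi>\<close> are the maps \<open>(\<psi> + t)\<^sup>-\<^sup>1\<close>, so every question about
  \<open>q\<close>-positivity and \<open>q\<close>-subordination of invertible maps becomes one about \<open>\<psi>\<close>.  The maps that decide
  everything are the Lyapunov maps \<open>L\<^sub>Y(A) = Y A + A Y\<^sup>*\<close>: the theorem reduces to the claim that a unital \<open>\<phi>\<close> is
  \<open>q\<close>-pure exactly when \<open>\<psi> = L\<^sub>Y\<close> for some \<open>Y\<close> with \<open>Y + Y\<^sup>* = 1\<close> (\<open>q_pure_iff_inverse_lyapunov\<close>).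
  Such a \<open>Y\<close> is \<open>1/2 + iH\<close> with \<open>H\<close> Hermitian.  In an eigenbasis of \<open>H\<close> the map \<open>L\<^sub>Y\<close> multiplies the
  \<open>(j, k)\<close> entry by \<open>1 + i(\<lambda>\<^sub>j - \<lambda>\<^sub>k)\<close>, and since only differences of eigenvalues occur, they can be shifted
  to have sum zero.

  Suppose that \<open>\<phi>\<close> is \<open>q\<close>-pure.  The expansion \<open>t\<^sup>2 (\<psi> + t)\<^sup>-\<^sup>1 = t - \<psi> + o(1)\<close> for \<open>t \<rightarrow> \<infinity>\<close> shows that
  the Choi matrix of \<open>-\<psi>\<close> is positive semidefinite on the orthogonal complement of the vector \<open>\<Omega>\<close>
  for which \<open>\<Omega> \<Omega>\<^sup>*\<close> is the Choi matrix of the identity map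
  (\<open>generator_conditionally_positive\<close>).  Compressing to this complement amounts to adding some
  \<open>L\<^sub>Y\<close>, so \<open>\<psi> = L\<^sub>Y - \<theta>\<close> with \<open>\<theta>\<close> completely positive (\<open>lyapunov_dominates_generator\<close>), which is the
  Lindblad form of a generator.  Dropping \<open>\<theta>\<close> gives a \<open>q\<close>-subordinate of \<open>\<phi>\<close>: as \<open>\<psi>(1) = 1\<close>, the
  matrix \<open>Y\<close> has positive definite real part, and then \<open>L\<^sub>Y + t\<close> has a completely positive inverse
  (\<open>completely_positive_inv_lyapunov\<close>).  Purity forces \<open>L\<^sub>Y = \<psi> + s\<close>, that is \<open>\<theta> = s \<cdot> id\<close>; because the
  compression annihilates one diagonal Choi entry at which the identity map has the entry \<open>1\<close>, this
  means \<open>\<theta> = 0\<close>.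

  Conversely let \<open>\<psi> = L\<^sub>Y\<close> and let \<open>\<theta>\<close> be a \<open>q\<close>-subordinate of \<open>\<phi>\<close>.  The maps \<open>n \<theta>\<^sup>(\<^sup>n\<^sup>)\<close> are dominated
  by \<open>n \<phi>\<^sup>(\<^sup>n\<^sup>)\<close>, which converges to the identity, so they accumulate at a completely positive map below
  the identity, hence at a multiple \<open>s \<cdot> id\<close>.  The resolvent identity then yields \<open>s\<theta> = \<theta>\<close>, so
  either \<open>\<theta> = 0\<close> or \<open>s = 1\<close>, and in the latter case the range of \<open>\<theta>\<close> is everything
  (\<open>q_subordinate_zero_or_bij\<close>).  If \<open>\<theta>\<close> is invertible, then \<open>\<theta>\<^sup>-\<^sup>1 - \<psi>\<close> is completely positive, while its
  Choi form is nonpositive on \<open>\<Omega>\<^sup>\<bottom>\<close>, where that of \<open>L\<^sub>Y\<close> vanishes; a positive semidefinite form that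
  vanishes on \<open>\<Omega>\<^sup>\<bottom>\<close> is a multiple of \<open>\<Omega> \<Omega>\<^sup>*\<close>, so \<open>\<theta>\<^sup>-\<^sup>1 = \<psi> + s\<close> and \<open>\<theta> = \<phi>\<^sup>(\<^sup>s\<^sup>)\<close>
  (\<open>q_subordinate_inv_lyapunov\<close>).
\<close>

section \<open>Hermitian forms and the spectral theorem\<close>

lemma cinner_vec_add_right: "cinner_vec x (y + z) = cinner_vec x y + cinner_vec x z"
  by (simp add: cinner_vec_def algebra_simps sum.distrib)

lemma cinner_vec_diff_right: "cinner_vec x (y - z) = cinner_vec x y - cinner_vec x z"
  by (simp add: cinner_vec_def algebra_simps sum_subtractf)

lemma cinner_vec_scale_right: "cinner_vec x (c *s y) = c * cinner_vec x y"
  by (simp add: cinner_vec_def sum_distrib_left algebra_simps)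

lemma cinner_vec_zero_right [simp]: "cinner_vec x 0 = 0"
  by (simp add: cinner_vec_def)

lemma cinner_vec_commute: "cinner_vec y x = cnj (cinner_vec x y)"
  by (simp add: cinner_vec_def mult.commute)

lemma cinner_vec_add_left: "cinner_vec (x + y) z = cinner_vec x z + cinner_vec y z"
  by (simp add: cinner_vec_def algebra_simps sum.distrib)

lemma cinner_vec_scale_left: "cinner_vec (c *s x) y = cnj c * cinner_vec x y"
  by (simp add: cinner_vec_def sum_distrib_left algebra_simps)

lemma cinner_vec_diff_left: "cinner_vec (x - y) z = cinner_vec x z - cinner_vec y z"
  by (simp add: cinner_vec_def algebra_simps sum_subtractf)

lemma Re_cinner_vec: "Re (cinner_vec x y) = x \<bullet> y"
  by (simp add: cinner_vec_def inner_vec_def inner_complex_def)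

lemma cinner_vec_self: "cinner_vec x x = of_real ((norm x)\<^sup>2)"
proof (rule complex_eqI)
  show "Re (cinner_vec x x) = Re (of_real ((norm x)\<^sup>2))"
    by (simp add: Re_cinner_vec dot_square_norm)
  show "Im (cinner_vec x x) = Im (of_real ((norm x)\<^sup>2))"
    by (simp add: cinner_vec_def)
qed

lemma cinner_vec_matrix: "cinner_vec x (A *v y) = (\<Sum>a\<in>UNIV. \<Sum>b\<in>UNIV. cnj (x $ a) * A $ a $ b * y $ b)"
  by (simp add: cinner_vec_def matrix_vector_mult_def sum_distrib_left mult.assoc)

lemma conj_transpose_nth: "conj_transpose A $ i $ j = cnj (A $ j $ i)"
  by (simp add: conj_transpose_def transpose_def map_matrix_def)

lemma mscale_nth: "mscale c A $ i $ j = c * A $ i $ j"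
  by (simp add: mscale_def map_matrix_def)

lemma conj_transpose_mult: "conj_transpose (A ** B) = conj_transpose B ** conj_transpose A"
  by (simp add: vec_eq_iff conj_transpose_nth matrix_matrix_mult_def mult.commute)

lemma conj_transpose_conj_transpose: "conj_transpose (conj_transpose A) = A"
  by (simp add: vec_eq_iff conj_transpose_nth)

lemma conj_transpose_add: "conj_transpose (A + B) = conj_transpose A + conj_transpose B"
  by (simp add: vec_eq_iff conj_transpose_nth)

lemma conj_transpose_diff: "conj_transpose (A - B) = conj_transpose A - conj_transpose B"
  by (simp add: vec_eq_iff conj_transpose_nth)

lemma cinner_vec_adjoint: "cinner_vec x (A *v y) = cinner_vec (conj_transpose A *v x) y"
proof -
  have "cinner_vec (conj_transpose A *v x) y = (\<Sum>b\<in>UNIV. \<Sum>a\<in>UNIV. cnj (x $ a) * A $ a $ b * y $ b)"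
    by (simp add: cinner_vec_def matrix_vector_mult_def conj_transpose_nth sum_distrib_right
        sum_distrib_left mult_ac)
  then show ?thesis
    unfolding cinner_vec_matrix by (subst sum.swap) simp
qed

text \<open>
  Conjugating the members of the family gives the rows of a linear system; the row with index
  outside \<open>S\<close> is zero, so the system is singular and has a nontrivial solution.
\<close>

lemma exists_orthogonal_to_proper_family:
  fixes f :: "'n \<Rightarrow> complex^'n"
  assumes "j \<notin> S"
  shows "\<exists>x. x \<noteq> 0 \<and> (\<forall>i\<in>S. cinner_vec (f i) x = 0)"
proof (rule ccontr)
  assume neg: "\<not> ?thesis"
  define A :: "complex^'n^'n" where "A = (\<chi> i p. if i \<in> S then cnj (f i $ p) else 0)"
  have "A *v x = 0 \<longrightarrow> x = 0" for x
  proof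
    assume 0: "A *v x = 0"
    have "cinner_vec (f i) x = 0" if "i \<in> S" for i
    proof -
      have "cinner_vec (f i) x = (A *v x) $ i"
        using that by (simp add: A_def matrix_vector_mult_def cinner_vec_def)
      then show ?thesis using 0 by simp
    qed
    then show "x = 0" using neg by blast
  qed
  then obtain B where "B ** A = mat 1"
    using matrix_left_invertible_ker[of A] by blast
  then have "det B * det A = 1"
    by (metis det_I det_mul)
  moreover have "det A = 0"
    by (rule det_zero_row(1)[of j]) (simp add: A_def assms row_def vec_eq_iff)
  ultimately show False by simp
qed

lemma nonneg_quadratic_imp_linear_coeff_zero:
  fixes a b :: real
  assumes "\<And>t. 0 \<le> 2 * t * a + t\<^sup>2 * b"
  shows "a = 0"
proof (rule ccontr)
  assume "a \<noteq> 0"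
  \<comment> \<open>At \<open>t = - a / d\<close> the linear term outweighs the quadratic one because \<open>b < d\<close>.\<close>
  define d where "d = \<bar>b\<bar> + 1"
  have d: "d > 0" "b < d" by (simp_all add: d_def)
  have "2 * (- a / d) * a + (- a / d)\<^sup>2 * b = a\<^sup>2 / d * (b / d - 2)"
    using d by (simp add: field_simps power2_eq_square)
  moreover have "b / d < 2" using d by (simp add: field_simps)
  ultimately have "2 * (- a / d) * a + (- a / d)\<^sup>2 * b < 0"
    using \<open>a \<noteq> 0\<close> d by (metis diff_less_0_iff_less divide_pos_pos mult_pos_neg zero_less_power2)
  then show False using assms[of "- a / d"] by linarith
qed

text \<open>
  The Rayleigh quotient attains its minimum \<open>\<mu>\<close> over the unit sphere of \<open>W\<close> at some \<open>w\<close>.  The form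
  \<open>v \<bullet> (f v - \<mu> v)\<close> is then nonnegative on \<open>W\<close> and vanishes at \<open>w\<close>, so its derivative at \<open>w\<close> in the
  direction \<open>z = f w - \<mu> w\<close>, which is \<open>2 (z \<bullet> z)\<close>, must be zero.
\<close>

lemma self_adjoint_eigenvector_in_subspace:
  fixes f :: "'a::euclidean_space \<Rightarrow> 'a"
  assumes f: "linear f" and sym: "\<And>x y. x \<bullet> f y = f x \<bullet> y"
    and W: "subspace W" and inv: "\<And>x. x \<in> W \<Longrightarrow> f x \<in> W"
    and x: "x \<in> W" "x \<noteq> 0"
  shows "\<exists>w \<mu>. w \<in> W \<and> norm w = 1 \<and> f w = \<mu> *\<^sub>R w"
proof -
  have cont: "continuous_on A f" for A
    using f by (simp add: linear_continuous_on linear_conv_bounded_linear)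
  have "compact (sphere 0 1 \<inter> W)"
    by (intro compact_Int_closed compact_sphere closed_subspace W)
  moreover have "x /\<^sub>R norm x \<in> sphere 0 1 \<inter> W"
    using x W by (simp add: subspace_scale)
  moreover have "continuous_on (sphere 0 1 \<inter> W) (\<lambda>v. v \<bullet> f v)"
    by (intro continuous_on_inner continuous_on_id cont)
  ultimately obtain w where w: "w \<in> sphere 0 1 \<inter> W"
    and min: "\<And>v. v \<in> sphere 0 1 \<inter> W \<Longrightarrow> w \<bullet> f w \<le> v \<bullet> f v"
    using continuous_attains_inf[of "sphere 0 1 \<inter> W" "\<lambda>v. v \<bullet> f v"] by blast
  define \<mu> where "\<mu> = w \<bullet> f w"
  have ge: "0 \<le> v \<bullet> (f v - \<mu> *\<^sub>R v)" if "v \<in> W" for v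
  proof (cases "v = 0")
    case False
    have "v /\<^sub>R norm v \<in> sphere 0 1 \<inter> W"
      using False that W by (simp add: subspace_scale)
    from min[OF this] have "\<mu> \<le> (v \<bullet> f v) / (norm v)\<^sup>2"
      using f by (simp add: \<mu>_def linear_cmul power2_eq_square divide_simps)
    then have "\<mu> * (norm v)\<^sup>2 \<le> v \<bullet> f v"
      using False by (simp add: field_simps)
    then show ?thesis by (simp add: inner_diff_right power2_norm_eq_inner)
  qed simp
  define z where "z = f w - \<mu> *\<^sub>R w"
  have zW: "z \<in> W" using w inv W by (simp add: z_def subspace_diff subspace_scale)
  have wz: "w \<bullet> z = 0" using w by (simp add: z_def \<mu>_def inner_diff_right dot_square_norm)
  have "z \<bullet> z = 0"
  proof (rule nonneg_quadratic_imp_linear_coeff_zero)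
    fix t :: real
    let ?g = "f z - \<mu> *\<^sub>R z"
    have "w \<bullet> ?g = z \<bullet> z"
      using sym[of w z] by (simp add: z_def inner_diff_right inner_diff_left inner_commute algebra_simps)
    moreover have "f (w + t *\<^sub>R z) - \<mu> *\<^sub>R (w + t *\<^sub>R z) = z + t *\<^sub>R ?g"
    proof -
      have "f w = z + \<mu> *\<^sub>R w" by (simp add: z_def)
      then show ?thesis using f by (simp add: linear_add linear_cmul algebra_simps)
    qed
    moreover have "w + t *\<^sub>R z \<in> W"
      using w zW W by (simp add: subspace_add subspace_scale)
    ultimately show "0 \<le> 2 * t * (z \<bullet> z) + t\<^sup>2 * (z \<bullet> ?g)"
      using ge[of "w + t *\<^sub>R z"] wz
      by (simp add: inner_add_left inner_add_right power2_eq_square algebra_simps)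
  qed
  then have "f w = \<mu> *\<^sub>R w" by (simp add: z_def)
  with w show ?thesis by auto
qed

definition hermitian :: "complex^'m^'m \<Rightarrow> bool"
  where "hermitian H \<longleftrightarrow> conj_transpose H = H"

definition diagonal :: "('m \<Rightarrow> complex) \<Rightarrow> complex^'m^'m"
  where "diagonal d = (\<chi> i j. if i = j then d i else 0)"

lemma scaleR_vec_eq_smult: "t *\<^sub>R (x :: complex^'m) = of_real t *s x"
  by (simp add: vec_eq_iff scaleR_conv_of_real[where 'a = complex])

lemma matrix_vector_mult_smult: "A *v (c *s x) = c *s (A *v (x :: complex^'m))"
  by (simp add: vec_eq_iff matrix_vector_mult_def sum_distrib_left mult_ac)

lemma linear_matrix_vector_mult_complex: "linear (\<lambda>x. (A :: complex^'m^'k) *v x)"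
  by (rule linearI)
    (simp_all add: matrix_vector_right_distrib matrix_vector_mult_smult scaleR_vec_eq_smult)

text \<open>
  The index set of the family grows one index at a time: the common orthogonal complement of the
  eigenvectors found so far is invariant and nonzero, so it contains a further eigenvector.
\<close>

lemma hermitian_orthonormal_eigenvectors:
  fixes H :: "complex^'m^'m"
  assumes H: "hermitian H"
  shows "\<exists>(f :: 'm \<Rightarrow> complex^'m) l. (\<forall>i\<in>S. H *v f i = of_real (l i) *s f i) \<and>
    (\<forall>i\<in>S. \<forall>j\<in>S. cinner_vec (f i) (f j) = (if i = j then 1 else 0))"
proof (induction S rule: finite_induct[OF finite])
  case (2 k S)
  then obtain f :: "'m \<Rightarrow> complex^'m" and l where f: "\<And>i. i \<in> S \<Longrightarrow> H *v f i = of_real (l i) *s f i"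
    and on: "\<And>i j. i \<in> S \<Longrightarrow> j \<in> S \<Longrightarrow> cinner_vec (f i) (f j) = (if i = j then 1 else 0)"
    by blast
  define W where "W = {x. \<forall>i\<in>S. cinner_vec (f i) x = 0}"
  obtain x where x: "x \<in> W" "x \<noteq> 0"
    using exists_orthogonal_to_proper_family[OF \<open>k \<notin> S\<close>, of f] by (auto simp: W_def)
  have "\<exists>w \<mu>. w \<in> W \<and> norm w = 1 \<and> H *v w = \<mu> *\<^sub>R w"
  proof (rule self_adjoint_eigenvector_in_subspace)
    show "linear ((*v) H)" by (rule linear_matrix_vector_mult_complex)
    show "x \<bullet> (H *v y) = (H *v x) \<bullet> y" for x y
      using H by (metis Re_cinner_vec cinner_vec_adjoint hermitian_def)
    show "subspace W"
      by (rule subspaceI)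
        (auto simp: W_def cinner_vec_add_right cinner_vec_scale_right scaleR_vec_eq_smult)
    show "H *v x \<in> W" if "x \<in> W" for x
    proof -
      have "cinner_vec (f i) (H *v x) = 0" if i: "i \<in> S" for i
      proof -
        have "cinner_vec (f i) (H *v x) = cinner_vec (H *v f i) x"
          using H by (simp add: cinner_vec_adjoint hermitian_def)
        also have "\<dots> = 0"
          using i \<open>x \<in> W\<close> by (simp add: f cinner_vec_scale_left W_def)
        finally show ?thesis .
      qed
      then show ?thesis by (simp add: W_def)
    qed
  qed (use x in auto)
  then obtain w \<mu> where w: "w \<in> W" "norm w = 1" "H *v w = \<mu> *\<^sub>R w" by blast
  have w1: "cinner_vec (f i) w = 0" "cinner_vec w (f i) = 0" if "i \<in> S" for i
    using that w(1) cinner_vec_commute[of w "f i"] by (auto simp: W_def)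
  have ww: "cinner_vec w w = 1" by (simp add: cinner_vec_self w(2))
  show ?case
    using f on ww w(3) w1 \<open>k \<notin> S\<close>
    by (intro exI[of _ "f(k := w)"] exI[of _ "l(k := \<mu>)"])
      (auto simp: scaleR_vec_eq_smult)
qed simp

theorem spectral_theorem:
  fixes H :: "complex^'m^'m"
  assumes "hermitian H"
  obtains U l where "unitary U" "H = U ** diagonal (\<lambda>i. of_real (l i)) ** conj_transpose U"
proof -
  obtain f :: "'m \<Rightarrow> complex^'m" and l where f: "\<And>i. H *v f i = of_real (l i) *s f i"
    and on: "\<And>i j. cinner_vec (f i) (f j) = (if i = j then 1 else 0)"
    using hermitian_orthonormal_eigenvectors[OF assms, of UNIV] by blast
  define U :: "complex^'m^'m" where "U = (\<chi> p j. f j $ p)"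
  have UU: "conj_transpose U ** U = mat 1"
    using on by (simp add: vec_eq_iff matrix_matrix_mult_def conj_transpose_nth U_def mat_def
        cinner_vec_def)
  then have UU': "U ** conj_transpose U = mat 1"
    using matrix_left_right_inverse by blast
  have "H ** U = U ** diagonal (\<lambda>i. of_real (l i))"
  proof -
    have "(H ** U) $ p $ j = (H *v f j) $ p" for p j
      by (simp add: matrix_matrix_mult_def matrix_vector_mult_def U_def)
    moreover have "(U ** diagonal (\<lambda>i. of_real (l i))) $ p $ j = (of_real (l j) *s f j) $ p" for p j
      by (simp add: matrix_matrix_mult_def diagonal_def U_def if_distrib cong: if_cong)
    ultimately show ?thesis by (simp add: vec_eq_iff f)
  qed
  then have "H = U ** diagonal (\<lambda>i. of_real (l i)) ** conj_transpose U"
    by (metis UU' matrix_mul_assoc matrix_mul_rid)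
  then show thesis using UU UU' that by (auto simp: unitary_def)
qed

section \<open>Positive semidefinite matrices\<close>

definition psd :: "complex^'m^'m \<Rightarrow> bool"
  where "psd M \<longleftrightarrow> (\<forall>x. cinner_vec x (M *v x) \<in> \<real>\<^sub>\<ge>\<^sub>0)"

lemma psdD: "psd M \<Longrightarrow> cinner_vec x (M *v x) \<in> \<real>\<^sub>\<ge>\<^sub>0"
  by (simp add: psd_def)

lemma hermitian_entry: "hermitian H \<Longrightarrow> cnj (H $ b $ a) = H $ a $ b"
  unfolding hermitian_def conj_transpose_nth[symmetric] by simp

lemma cinner_vec_axis: "cinner_vec (axis c 1) y = y $ c"
proof -
  have "cinner_vec (axis c 1) y = (\<Sum>r\<in>UNIV. if c = r then y $ r else 0)"
    unfolding cinner_vec_def by (rule sum.cong) (simp_all add: axis_def)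
  then show ?thesis by simp
qed

lemma cinner_vec_axis_right: "cinner_vec y (axis c 1) = cnj (y $ c)"
  using cinner_vec_commute[of y "axis c 1"] by (simp add: cinner_vec_axis)

lemma matrix_vector_mult_axis: "(M *v axis c 1) $ a = M $ a $ (c :: 'm::finite)" for M :: "complex^'m^'k"
proof -
  have "(M *v axis c 1) $ a = (\<Sum>s\<in>UNIV. if c = s then M $ a $ s else 0)"
    unfolding matrix_vector_mult_def vec_lambda_beta by (rule sum.cong) (simp_all add: axis_def)
  then show ?thesis by simp
qed

lemma cinner_vec_axis_combination:
  fixes M :: "complex^'m^'m"
  shows
  "cinner_vec (axis a 1 + u *s axis b 1) (M *v (axis a 1 + u *s axis b 1)) =
    M $ a $ a + u * M $ a $ b + cnj u * M $ b $ a + cnj u * u * M $ b $ b"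
proof -
  have ax: "cinner_vec (axis p 1) (M *v axis q 1) = M $ p $ q" for p q
    by (simp add: cinner_vec_axis matrix_vector_mult_axis)
  show ?thesis
    by (simp add: matrix_vector_right_distrib matrix_vector_mult_smult cinner_vec_add_left
      cinner_vec_add_right cinner_vec_scale_left cinner_vec_scale_right ax algebra_simps)
qed

lemma psd_diag: "psd M \<Longrightarrow> M $ a $ a \<in> \<real>\<^sub>\<ge>\<^sub>0"
  using psdD[of M "axis a 1 + 0 *s axis a 1"] unfolding cinner_vec_axis_combination by simp

lemma psd_imp_hermitian:
  assumes "psd M"
  shows "hermitian M"
proof -
  have "cnj (M $ b $ a) = M $ a $ b" for a b
  proof -
    have d: "Im (M $ a $ a) = 0" "Im (M $ b $ b) = 0"
      using psd_diag[OF assms, of a] psd_diag[OF assms, of b] by (simp_all add: complex_nonneg_Reals_iff)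
    have "Im (M $ a $ a + u * M $ a $ b + cnj u * M $ b $ a + cnj u * u * M $ b $ b) = 0" for u
      using psdD[OF assms, of "axis a 1 + u *s axis b 1"] unfolding cinner_vec_axis_combination
      by (simp only: complex_nonneg_Reals_iff)
    from this[of 1] this[of \<i>] show ?thesis
      using d by (simp add: complex_eq_iff)
  qed
  then show ?thesis by (simp add: hermitian_def vec_eq_iff conj_transpose_nth)
qed

text \<open>
  Evaluating the form at \<open>e\<^sub>a + u e\<^sub>b\<close>, where \<open>|u| = 1\<close> turns the entry \<open>M\<^sub>a\<^sub>b\<close> onto the negative real axis,
  gives \<open>M\<^sub>a\<^sub>a - 2 |M\<^sub>a\<^sub>b| + M\<^sub>b\<^sub>b \<ge> 0\<close>.
\<close>

lemma psd_entry_bound: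
  assumes "psd M"
  shows "cmod (M $ a $ b) \<le> (Re (M $ a $ a) + Re (M $ b $ b)) / 2"
proof (cases "M $ a $ b = 0")
  case True
  then show ?thesis
    using psd_diag[OF assms, of a] psd_diag[OF assms, of b] by (simp add: complex_nonneg_Reals_iff)
next
  case False
  define z where "z = M $ a $ b"
  define u where "u = - cnj z / of_real (cmod z)"
  have z: "cmod z \<noteq> 0" using False by (simp add: z_def)
  have ba: "M $ b $ a = cnj z"
    using hermitian_entry[OF psd_imp_hermitian[OF assms], of a b] by (simp add: z_def)
  have zz: "z * cnj z = of_real (cmod z) * of_real (cmod z)"
    using complex_norm_square[of z] by (simp add: power2_eq_square)
  have "u * z = - (z * cnj z / of_real (cmod z))" by (simp add: u_def)
  then have uz: "u * M $ a $ b = - of_real (cmod z)"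
    unfolding zz z_def[symmetric] using z by simp
  have uz': "cnj u * M $ b $ a = - of_real (cmod z)"
  proof -
    have "cnj (u * z) = - of_real (cmod z)" using uz unfolding z_def[symmetric] by simp
    then show ?thesis by (simp add: ba)
  qed
  have "cnj u * u = z * cnj z / (of_real (cmod z) * of_real (cmod z))"
    by (simp add: u_def)
  then have uu: "cnj u * u = 1" unfolding zz using z by simp
  have "Re (M $ a $ a + u * M $ a $ b + cnj u * M $ b $ a + cnj u * u * M $ b $ b) \<ge> 0"
    using psdD[OF assms, of "axis a 1 + u *s axis b 1"] unfolding cinner_vec_axis_combination
    by (simp only: complex_nonneg_Reals_iff)
  then show ?thesis unfolding uz uz' uu by (simp add: z_def)
qed

lemma norm_le_sum_entries: "norm (M :: complex^'m^'k) \<le> (\<Sum>a\<in>UNIV. \<Sum>b\<in>UNIV. cmod (M $ a $ b))"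
proof -
  have "norm M \<le> (\<Sum>a\<in>UNIV. norm (M $ a))"
    unfolding norm_vec_def[of M] by (rule L2_set_le_sum) simp
  also have "\<dots> \<le> (\<Sum>a\<in>UNIV. \<Sum>b\<in>UNIV. cmod (M $ a $ b))"
    by (rule sum_mono) (unfold norm_vec_def, rule L2_set_le_sum, simp)
  finally show ?thesis .
qed

text \<open>
  All entries of \<open>M\<close> are bounded by its diagonal, and the diagonal grows with the matrix.  The constant
  is crude; the lemma serves to confine a dominated sequence of matrices to a compact set.
\<close>

lemma psd_norm_mono:
  fixes M N :: "complex^'m^'m"
  assumes "psd M" and "psd (N - M)"
  shows "norm M \<le> (real CARD('m))\<^sup>2 * norm N"
proof -
  have d: "Re (M $ a $ a) \<le> norm N" for a
  proof -
    have "Re (M $ a $ a) \<le> Re (N $ a $ a)"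
      using psd_diag[OF assms(2), of a] by (simp add: complex_nonneg_Reals_iff)
    also have "\<dots> \<le> cmod (N $ a $ a)" by (rule complex_Re_le_cmod)
    also have "\<dots> \<le> norm N" by (meson component_le_norm_cart Finite_Cartesian_Product.norm_nth_le order_trans)
    finally show ?thesis .
  qed
  have "cmod (M $ a $ b) \<le> norm N" for a b
    using psd_entry_bound[OF assms(1), of a b] d[of a] d[of b] by simp
  then have "(\<Sum>a\<in>UNIV. \<Sum>b\<in>UNIV. cmod (M $ a $ b)) \<le> (\<Sum>a\<in>(UNIV::'m set). \<Sum>b\<in>(UNIV::'m set). norm N)"
    by (intro sum_mono) simp
  with norm_le_sum_entries[of M] show ?thesis by (simp add: power2_eq_square mult.assoc)
qed

lemma tendsto_quadratic_form:
  fixes M :: "'x \<Rightarrow> complex^'m^'m"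
  assumes "(M \<longlongrightarrow> N) F"
  shows "((\<lambda>t. cinner_vec x (M t *v x)) \<longlongrightarrow> cinner_vec x (N *v x)) F"
  unfolding cinner_vec_matrix by (intro tendsto_intros assms)

lemma psd_tendsto:
  fixes M :: "'x \<Rightarrow> complex^'m^'m"
  assumes "(M \<longlongrightarrow> N) F" "eventually (\<lambda>t. psd (M t)) F" "F \<noteq> bot"
  shows "psd N"
  unfolding psd_def
proof
  fix x
  show "cinner_vec x (N *v x) \<in> \<real>\<^sub>\<ge>\<^sub>0"
    by (rule Lim_in_closed_set[OF closed_nonneg_Reals_complex _ assms(3) tendsto_quadratic_form[OF assms(1)]])
      (use assms(2) in \<open>auto elim: eventually_mono dest: psdD\<close>)
qed

lemma hermitian_eigenvector:
  assumes "unitary U" "H = U ** diagonal d ** conj_transpose U"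
  shows "H *v column r U = d r *s column r U" "norm (column r U) = 1"
proof -
  have "H ** U = U ** diagonal d"
    using assms by (metis matrix_mul_assoc matrix_mul_rid unitary_def)
  then have "(H ** U) $ p $ r = (U ** diagonal d) $ p $ r" for p by simp
  then show "H *v column r U = d r *s column r U"
    by (simp add: vec_eq_iff matrix_matrix_mult_def matrix_vector_mult_def column_def diagonal_def
        if_distrib mult.commute cong: if_cong)
  have "(conj_transpose U ** U) $ r $ r = 1"
    using assms by (simp add: unitary_def mat_def)
  then have "cinner_vec (column r U) (column r U) = 1"
    by (simp add: cinner_vec_def column_def matrix_matrix_mult_def conj_transpose_nth)
  then show "norm (column r U) = 1"
    unfolding cinner_vec_self of_real_eq_1_iff by (smt (verit) norm_ge_zero power2_eq_1_iff)
qed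

lemma spectral_entries:
  assumes "H = U ** diagonal d ** conj_transpose U"
  shows "H $ a $ b = (\<Sum>r\<in>UNIV. d r * U $ a $ r * cnj (U $ b $ r))"
  by (simp add: assms matrix_matrix_mult_def diagonal_def conj_transpose_nth if_distrib mult_ac
      cong: if_cong)

lemma nonneg_Reals_sum:
  "(\<And>i. i \<in> S \<Longrightarrow> f i \<in> \<real>\<^sub>\<ge>\<^sub>0) \<Longrightarrow> sum f S \<in> \<real>\<^sub>\<ge>\<^sub>0"
  by (induction S rule: infinite_finite_induct) auto

lemma cinner_vec_diagonal:
  "cinner_vec y (diagonal d *v y) = (\<Sum>r\<in>UNIV. d r * (cnj (y $ r) * y $ r))"
proof -
  have "(diagonal d *v y) $ r = (\<Sum>s\<in>UNIV. if r = s then d s * y $ s else 0)" for r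
    unfolding matrix_vector_mult_def vec_lambda_beta by (rule sum.cong) (simp_all add: diagonal_def)
  then show ?thesis by (simp add: cinner_vec_def mult_ac)
qed

lemma psd_spectralI:
  fixes H :: "complex^'m^'m"
  assumes "H = U ** diagonal (\<lambda>i. of_real (l i)) ** conj_transpose U" and "\<And>r. l r \<ge> 0"
  shows "psd H"
  unfolding psd_def
proof
  fix x
  define y where "y = conj_transpose U *v x"
  have "cinner_vec x (H *v x) = cinner_vec y (diagonal (\<lambda>i. of_real (l i)) *v y)"
    by (simp add: assms(1) y_def cinner_vec_adjoint conj_transpose_mult
        matrix_vector_mul_assoc[symmetric] conj_transpose_conj_transpose)
  also have "\<dots> = (\<Sum>r\<in>UNIV. of_real (l r * (cmod (y $ r))\<^sup>2))"
    unfolding cinner_vec_diagonal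
    by (rule sum.cong) (simp_all only: of_real_mult complex_norm_square mult_ac)
  also have "\<dots> \<in> \<real>\<^sub>\<ge>\<^sub>0"
    using assms(2) by (intro nonneg_Reals_sum) simp
  finally show "cinner_vec x (H *v x) \<in> \<real>\<^sub>\<ge>\<^sub>0" .
qed

text \<open>
  The spectral theorem writes \<open>M\<close> as a sum of rank one forms with nonnegative weights; applied to a
  Choi matrix this will produce Kraus operators.
\<close>

lemma psd_decomposition:
  fixes M :: "complex^'m^'m"
  assumes "psd M"
  obtains U :: "complex^'m^'m" and l :: "'m \<Rightarrow> real" where "\<And>r. l r \<ge> 0"
    "\<And>a b. M $ a $ b = (\<Sum>r\<in>UNIV. of_real (l r) * U $ a $ r * cnj (U $ b $ r))"
proof -
  obtain U l where U: "unitary U" and M: "M = U ** diagonal (\<lambda>i. of_real (l i)) ** conj_transpose U"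
    using spectral_theorem[OF psd_imp_hermitian[OF assms]] .
  have "l r \<ge> 0" for r
    using psdD[OF assms, of "column r U"] hermitian_eigenvector[OF U M, of r]
    by (simp add: cinner_vec_scale_right cinner_vec_self)
  then show thesis by (rule that[of l U, OF _ spectral_entries[OF M]])
qed

section \<open>Complex linear maps and complete positivity\<close>

lemma clinear_map_iff:
  "clinear_map f \<longleftrightarrow> (\<forall>A B. f (A + B) = f A + f B) \<and> (\<forall>c A. f (mscale c A) = mscale c (f A))"
  unfolding clinear_map_def Vector_Spaces.linear_iff using vector_space_mscale by auto

lemma
  assumes "clinear_map f"
  shows clinear_map_add: "f (A + B) = f A + f B"
    and clinear_map_mscale: "f (mscale c A) = mscale c (f A)"
    and clinear_map_scaleR: "f (t *\<^sub>R A) = t *\<^sub>R f A"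
    and clinear_map_imp_linear: "linear f"
proof -
  show 1: "f (A + B) = f A + f B" for A B using assms by (simp add: clinear_map_iff)
  show 2: "f (mscale c A) = mscale c (f A)" for A c using assms by (simp add: clinear_map_iff)
  show 3: "f (t *\<^sub>R A) = t *\<^sub>R f A" for A t using 2[of "of_real t"] by (simp add: mscale_of_real)
  show "linear f" using 1 3 by (rule linearI)
qed

lemma mscale_add: "mscale c (A + B) = mscale c A + mscale c B"
  by (simp add: vec_eq_iff mscale_nth algebra_simps)

lemma mscale_diff: "mscale c (A - B) = mscale c A - mscale c B"
  by (simp add: vec_eq_iff mscale_nth algebra_simps)

lemma mscale_scaleR: "mscale c (t *\<^sub>R A) = t *\<^sub>R mscale c A"
  by (simp add: vec_eq_iff mscale_nth)

lemma mscale_mult: "mscale c A ** B = mscale c (A ** B)" "A ** mscale c B = mscale c (A ** B)"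
  by (simp_all add: vec_eq_iff mscale_nth matrix_matrix_mult_def sum_distrib_left mult_ac)

lemma matrix_matrix_mult_add_rdistrib: "(A + B) ** C = A ** C + B ** (C :: complex^'m^'k)"
  by (simp add: vec_eq_iff matrix_matrix_mult_def algebra_simps sum.distrib)

lemma clinear_map_id: "clinear_map (\<lambda>A. A)"
  by (simp add: clinear_map_iff)

lemma clinear_map_compose: "clinear_map f \<Longrightarrow> clinear_map g \<Longrightarrow> clinear_map (\<lambda>A. f (g A))"
  by (simp add: clinear_map_iff)

lemma clinear_map_plus: "clinear_map f \<Longrightarrow> clinear_map g \<Longrightarrow> clinear_map (\<lambda>A. f A + g A)"
  by (simp add: clinear_map_iff mscale_add)

lemma clinear_map_minus: "clinear_map f \<Longrightarrow> clinear_map g \<Longrightarrow> clinear_map (\<lambda>A. f A - g A)"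
  by (simp add: clinear_map_iff mscale_diff)

lemma clinear_map_scaleR_left: "clinear_map f \<Longrightarrow> clinear_map (\<lambda>A. t *\<^sub>R f A)"
  by (simp add: clinear_map_iff mscale_scaleR scaleR_add_right)

lemma clinear_map_inv:
  assumes "clinear_map f" "bij f"
  shows "clinear_map (inv f)"
proof -
  have f: "f (inv f A) = A" "inv f (f A) = A" for A
    using \<open>bij f\<close> by (simp_all add: bij_is_surj surj_f_inv_f bij_is_inj inv_f_f)
  have "inv f (A + B) = inv f A + inv f B" for A B
    using f(2)[of "inv f A + inv f B"] by (simp add: clinear_map_add[OF assms(1)] f(1))
  moreover have "inv f (mscale c A) = mscale c (inv f A)" for c A
    using f(2)[of "mscale c (inv f A)"] by (simp add: clinear_map_mscale[OF assms(1)] f(1))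
  ultimately show ?thesis by (simp add: clinear_map_iff)
qed

lemma matrix_unit_nth: "matrix_unit j k $ p $ q = (if p = j \<and> q = k then 1 else 0)"
  by (simp add: matrix_unit_def)

lemma matrix_unit_expansion:
  "A = (\<Sum>j\<in>UNIV. \<Sum>k\<in>UNIV. mscale (A $ j $ k) (matrix_unit j k))"
proof -
  have "(\<Sum>j\<in>UNIV. \<Sum>k\<in>UNIV. mscale (A $ j $ k) (matrix_unit j k)) $ p $ q
      = (\<Sum>j\<in>UNIV. \<Sum>k\<in>UNIV. if k = q then (if j = p then A $ j $ k else 0) else 0)" for p q
    unfolding sum_component mscale_nth matrix_unit_nth by (intro sum.cong) auto
  then show ?thesis by (simp add: vec_eq_iff)
qed

text \<open>
  The pairing of the indices makes the quadratic form of the Choi matrix the block form of \<open>\<phi>\<close> on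
  the positive block matrix \<open>(e\<^sub>j\<^sub>k)\<^sub>j\<^sub>k\<close>.  Complete positivity can be tested on this one block matrix.
\<close>

definition choi :: "(complex^'n^'n \<Rightarrow> complex^'n^'n) \<Rightarrow> complex^('n \<times> 'n)^('n \<times> 'n)"
  where "choi \<phi> = (\<chi> a b. \<phi> (matrix_unit (fst a) (fst b)) $ snd a $ snd b)"

lemma choi_nth: "choi \<phi> $ a $ b = \<phi> (matrix_unit (fst a) (fst b)) $ snd a $ snd b"
  by (simp add: choi_def)

lemma choi_diff: "choi (\<lambda>A. f A - g A) = choi f - choi g"
  by (simp add: vec_eq_iff choi_nth)

lemma choi_expansion:
  assumes "clinear_map \<phi>"
  shows "\<phi> A $ p $ q = (\<Sum>j\<in>UNIV. \<Sum>k\<in>UNIV. A $ j $ k * choi \<phi> $ (j, p) $ (k, q))"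
proof -
  have "\<phi> A = \<phi> (\<Sum>j\<in>UNIV. \<Sum>k\<in>UNIV. mscale (A $ j $ k) (matrix_unit j k))"
    using matrix_unit_expansion[of A] by simp
  also have "\<dots> = (\<Sum>j\<in>UNIV. \<Sum>k\<in>UNIV. mscale (A $ j $ k) (\<phi> (matrix_unit j k)))"
    by (simp only: linear_sum[OF clinear_map_imp_linear[OF assms]] clinear_map_mscale[OF assms])
  finally show ?thesis by (simp add: mscale_nth choi_nth)
qed

lemma choi_injective:
  assumes "clinear_map \<phi>" "clinear_map \<psi>" "choi \<phi> = choi \<psi>"
  shows "\<phi> = \<psi>"
  by (rule ext) (simp add: vec_eq_iff choi_expansion[OF assms(1)] choi_expansion[OF assms(2)] assms(3))

lemma tendsto_choi:
  assumes "\<And>A. ((\<lambda>t. f t A) \<longlongrightarrow> g A) F"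
  shows "((\<lambda>t. choi (f t)) \<longlongrightarrow> choi g) F"
  by (intro vec_tendstoI) (unfold choi_nth, intro tendsto_vec_nth assms)

lemma tendsto_from_choi:
  assumes "\<And>t. clinear_map (f t)" "clinear_map g" "((\<lambda>t. choi (f t)) \<longlongrightarrow> choi g) F"
  shows "((\<lambda>t. f t A) \<longlongrightarrow> g A) F"
  by (intro vec_tendstoI)
    (simp add: choi_expansion[OF assms(1)] choi_expansion[OF assms(2)], intro tendsto_intros assms(3))

lemma completely_positive_clinear: "completely_positive \<phi> \<Longrightarrow> clinear_map \<phi>"
  by (simp add: completely_positive_def)

lemma completely_positive_id: "completely_positive (\<lambda>A. A)"
  by (simp add: completely_positive_def clinear_map_id)

lemma completely_positive_zero: "completely_positive (\<lambda>A. 0)"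
  by (simp add: completely_positive_def clinear_map_iff block_positive_def mscale_def map_matrix_def
      vec_eq_iff)

lemma completely_positive_compose:
  "completely_positive f \<Longrightarrow> completely_positive g \<Longrightarrow> completely_positive (\<lambda>A. f (g A))"
  by (simp add: completely_positive_def clinear_map_compose)

lemma completely_positive_add:
  assumes "completely_positive f" "completely_positive g"
  shows "completely_positive (\<lambda>A. f A + g A)"
  using assms unfolding completely_positive_def block_positive_def
  by (simp add: clinear_map_plus matrix_vector_mult_add_rdistrib cinner_vec_add_right sum.distrib)

lemma scaleR_matrix_vector: "(t *\<^sub>R M) *v x = of_real t *s (M *v (x :: complex^'m))"
  by (simp add: vec_eq_iff matrix_vector_mult_def sum_distrib_left scaleR_conv_of_real[where 'a = complex]
      mult.assoc)

lemma completely_positive_scaleR: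
  assumes "completely_positive f" "t \<ge> 0"
  shows "completely_positive (\<lambda>A. t *\<^sub>R f A)"
  using assms unfolding completely_positive_def block_positive_def
  by (simp add: clinear_map_scaleR_left scaleR_matrix_vector cinner_vec_scale_right
      flip: sum_distrib_left)

lemma completely_positive_sum:
  assumes "\<And>i. i \<in> S \<Longrightarrow> completely_positive (f i)"
  shows "completely_positive (\<lambda>A. \<Sum>i\<in>S. f i A)"
  using assms
  by (induction S rule: infinite_finite_induct)
    (simp_all add: completely_positive_zero completely_positive_add)

lemma completely_positive_conjugation: "completely_positive (\<lambda>A. S ** A ** conj_transpose S)"
proof -
  have "clinear_map (\<lambda>A. S ** A ** conj_transpose S)"
    by (simp add: clinear_map_iff matrix_add_ldistrib matrix_matrix_mult_add_rdistrib
        mscale_mult)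
  moreover have "cinner_vec x (S ** A ** conj_transpose S *v y) =
      cinner_vec (conj_transpose S *v x) (A *v (conj_transpose S *v y))" for x y A
    by (simp add: cinner_vec_adjoint conj_transpose_mult conj_transpose_conj_transpose
        matrix_vector_mul_assoc matrix_mul_assoc)
  ultimately show ?thesis
    unfolding completely_positive_def block_positive_def by simp
qed

text \<open>
  Choi's theorem: a decomposition of the Choi matrix into rank one forms is a Kraus decomposition
  \<open>\<phi>(A) = \<Sum>\<^sub>r l\<^sub>r S\<^sub>r A S\<^sub>r\<^sup>*\<close>, where \<open>S\<^sub>r\<close> is the \<open>r\<close>-th eigenvector written as a matrix.
\<close>

lemma psd_choi_imp_completely_positive:
  fixes \<phi> :: "complex^'n^'n \<Rightarrow> complex^'n^'n"
  assumes "clinear_map \<phi>" "psd (choi \<phi>)"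
  shows "completely_positive \<phi>"
proof -
  obtain U :: "complex^('n \<times> 'n)^('n \<times> 'n)" and l where l: "\<And>r. l r \<ge> 0"
    and U: "\<And>a b. choi \<phi> $ a $ b = (\<Sum>r\<in>UNIV. of_real (l r) * U $ a $ r * cnj (U $ b $ r))"
    by (rule psd_decomposition[OF assms(2)], rule that)
  define S :: "'n \<times> 'n \<Rightarrow> complex^'n^'n" where "S r = (\<chi> p j. U $ (j, p) $ r)" for r
  have "\<phi> A $ p $ q = (\<Sum>r\<in>UNIV. l r *\<^sub>R (S r ** A ** conj_transpose (S r))) $ p $ q" for A p q
  proof -
    have "\<phi> A $ p $ q = (\<Sum>j\<in>UNIV. \<Sum>k\<in>UNIV. \<Sum>r\<in>UNIV.
        of_real (l r) * (U $ (j, p) $ r * A $ j $ k * cnj (U $ (k, q) $ r)))"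
      by (simp add: choi_expansion[OF assms(1)] U sum_distrib_left mult_ac)
    also have "\<dots> = (\<Sum>j\<in>UNIV. \<Sum>r\<in>UNIV. \<Sum>k\<in>UNIV.
        of_real (l r) * (U $ (j, p) $ r * A $ j $ k * cnj (U $ (k, q) $ r)))"
      by (rule sum.cong[OF refl], rule sum.swap)
    also have "\<dots> = (\<Sum>r\<in>UNIV. \<Sum>j\<in>UNIV. \<Sum>k\<in>UNIV.
        of_real (l r) * (U $ (j, p) $ r * A $ j $ k * cnj (U $ (k, q) $ r)))"
      by (rule sum.swap)
    also have "\<dots> = (\<Sum>r\<in>UNIV. \<Sum>k\<in>UNIV. \<Sum>j\<in>UNIV.
        of_real (l r) * (U $ (j, p) $ r * A $ j $ k * cnj (U $ (k, q) $ r)))"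
      by (rule sum.cong[OF refl], rule sum.swap)
    finally show ?thesis
      by (simp add: matrix_matrix_mult_def conj_transpose_nth S_def sum_distrib_left sum_distrib_right
          scaleR_conv_of_real[where 'a = complex] mult_ac)
  qed
  then have "\<phi> = (\<lambda>A. \<Sum>r\<in>UNIV. l r *\<^sub>R (S r ** A ** conj_transpose (S r)))"
    by (simp add: fun_eq_iff vec_eq_iff)
  moreover have "completely_positive \<dots>"
    by (intro completely_positive_sum completely_positive_scaleR completely_positive_conjugation l)
  ultimately show ?thesis by simp
qed

lemma sum_UNIV_prod: "(\<Sum>a\<in>UNIV. f a) = (\<Sum>j\<in>UNIV. \<Sum>p\<in>UNIV. f (j, p))"
  by (simp add: UNIV_Times_UNIV[symmetric] sum.cartesian_product' del: UNIV_Times_UNIV)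

lemma completely_positive_imp_psd_choi:
  fixes \<phi> :: "complex^'n^'n \<Rightarrow> complex^'n^'n"
  assumes "completely_positive \<phi>"
  shows "psd (choi \<phi>)"
  unfolding psd_def
proof
  fix y :: "complex^('n \<times> 'n)"
  \<comment> \<open>Block matrices are indexed by numbers, so the matrix units have to be enumerated first.\<close>
  obtain h where h: "bij_betw h {..<CARD('n)} (UNIV :: 'n set)"
    using ex_bij_betw_nat_finite[OF finite, of "UNIV :: 'n set"] unfolding atLeast0LessThan by blast
  have "block_positive CARD('n) (\<lambda>i j. matrix_unit (h i) (h j))"
    unfolding block_positive_def
  proof
    fix x :: "nat \<Rightarrow> complex^'n"
    let ?s = "\<Sum>i<CARD('n). x i $ h i"
    have "cinner_vec u (matrix_unit j k *v v) = cnj (u $ j) * v $ k" for u v :: "complex^'n" and j k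
    proof -
      have "cinner_vec u (matrix_unit j k *v v) =
          (\<Sum>a\<in>UNIV. \<Sum>b\<in>UNIV. if b = k then (if a = j then cnj (u $ a) * v $ b else 0) else 0)"
        unfolding cinner_vec_matrix matrix_unit_nth by (intro sum.cong) auto
      then show ?thesis by simp
    qed
    then have "(\<Sum>i<CARD('n). \<Sum>j<CARD('n). cinner_vec (x i) (matrix_unit (h i) (h j) *v x j)) =
        cnj ?s * ?s"
      by (simp add: sum_product)
    also have "\<dots> = of_real ((cmod ?s)\<^sup>2)"
      by (simp only: complex_norm_square mult.commute)
    finally show "(\<Sum>i<CARD('n). \<Sum>j<CARD('n). cinner_vec (x i) (matrix_unit (h i) (h j) *v x j)) \<in> \<real>\<^sub>\<ge>\<^sub>0"
      by (simp only: nonneg_Reals_of_real_iff zero_le_power2)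
  qed
  then have "block_positive CARD('n) (\<lambda>i j. \<phi> (matrix_unit (h i) (h j)))"
    using assms by (simp add: completely_positive_def)
  then have "(\<Sum>i<CARD('n). \<Sum>j<CARD('n). cinner_vec (\<chi> p. y $ (h i, p))
      (\<phi> (matrix_unit (h i) (h j)) *v (\<chi> p. y $ (h j, p)))) \<in> \<real>\<^sub>\<ge>\<^sub>0" (is "?S \<in> _")
    unfolding block_positive_def by (rule spec)
  also have "?S = (\<Sum>i<CARD('n). \<Sum>k\<in>UNIV. cinner_vec (\<chi> p. y $ (h i, p))
      (\<phi> (matrix_unit (h i) k) *v (\<chi> p. y $ (k, p))))"
    by (rule sum.cong[OF refl])
      (rule sum.reindex_bij_betw[OF h, of "\<lambda>k. cinner_vec (\<chi> p. y $ (h _, p))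
      (\<phi> (matrix_unit (h _) k) *v (\<chi> p. y $ (k, p)))"])
  also have "\<dots> = (\<Sum>j\<in>UNIV. \<Sum>k\<in>UNIV. cinner_vec (\<chi> p. y $ (j, p))
      (\<phi> (matrix_unit j k) *v (\<chi> p. y $ (k, p))))"
    by (rule sum.reindex_bij_betw[OF h, of "\<lambda>j. \<Sum>k\<in>UNIV. cinner_vec (\<chi> p. y $ (j, p))
      (\<phi> (matrix_unit j k) *v (\<chi> p. y $ (k, p)))"])
  also have "\<dots> = (\<Sum>j\<in>UNIV. \<Sum>p\<in>UNIV. \<Sum>k\<in>UNIV. \<Sum>q\<in>UNIV.
      cnj (y $ (j, p)) * choi \<phi> $ (j, p) $ (k, q) * y $ (k, q))"
    unfolding cinner_vec_matrix by (simp add: choi_nth) (rule sum.cong[OF refl], rule sum.swap)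
  also have "\<dots> = cinner_vec y (choi \<phi> *v y)"
    unfolding cinner_vec_matrix
    by (simp add: sum_UNIV_prod)
  finally show "cinner_vec y (choi \<phi> *v y) \<in> \<real>\<^sub>\<ge>\<^sub>0" .
qed

section \<open>Lyapunov maps\<close>

definition lyapunov :: "complex^'m^'m \<Rightarrow> complex^'m^'m \<Rightarrow> complex^'m^'m"
  where "lyapunov Z X = Z ** X + X ** conj_transpose Z"

definition accretive :: "complex^'m^'m \<Rightarrow> bool"
  where "accretive Z \<longleftrightarrow> (\<forall>v. v \<noteq> 0 \<longrightarrow> 0 < Re (cinner_vec v (Z *v v)))"

lemma mscale_zero: "mscale c 0 = 0"
  by (simp add: vec_eq_iff mscale_nth)

lemma clinear_map_lyapunov: "clinear_map (lyapunov Z)"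
  by (simp add: clinear_map_iff lyapunov_def matrix_add_ldistrib matrix_matrix_mult_add_rdistrib
      mscale_mult mscale_add algebra_simps)

lemma conj_transpose_lyapunov: "conj_transpose (lyapunov Z X) = lyapunov Z (conj_transpose X)"
  by (simp add: lyapunov_def conj_transpose_add conj_transpose_mult conj_transpose_conj_transpose
      add.commute)

text \<open>
  If \<open>X u = l u\<close>, then the form of \<open>Z X + X Z\<^sup>*\<close> at \<open>u\<close> equals \<open>2 l Re \<langle>u, Z u\<rangle>\<close>, so an eigenvalue of \<open>X\<close>
  has the sign of this form.
\<close>

lemma lyapunov_psd:
  fixes X :: "complex^'m^'m"
  assumes Z: "accretive Z" and X: "hermitian X" and L: "psd (lyapunov Z X)"
  shows "psd X"
proof -
  obtain U l where U: "unitary U" and XU: "X = U ** diagonal (\<lambda>i. of_real (l i)) ** conj_transpose U"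
    using spectral_theorem[OF X] .
  have "l r \<ge> 0" for r
  proof -
    define u where "u = column r U"
    have Xu: "X *v u = of_real (l r) *s u" and u: "norm u = 1"
      using hermitian_eigenvector[OF U XU, of r] by (simp_all add: u_def)
    define c where "c = cinner_vec u (Z *v u)"
    have "cinner_vec u (lyapunov Z X *v u) =
        cinner_vec u (Z *v (X *v u)) + cinner_vec u (X *v (conj_transpose Z *v u))"
      by (simp add: lyapunov_def matrix_vector_mult_add_rdistrib cinner_vec_add_right
          matrix_vector_mul_assoc)
    also have "cinner_vec u (Z *v (X *v u)) = of_real (l r) * c"
      by (simp add: Xu c_def matrix_vector_mult_smult cinner_vec_scale_right)
    also have "cinner_vec u (X *v (conj_transpose Z *v u)) = of_real (l r) * cinner_vec u (conj_transpose Z *v u)"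
      using X by (simp add: cinner_vec_adjoint[of u X] hermitian_def Xu cinner_vec_scale_left)
    also have "cinner_vec u (conj_transpose Z *v u) = cnj c"
      unfolding c_def
      by (simp add: cinner_vec_adjoint[of u "conj_transpose Z"] conj_transpose_conj_transpose
          cinner_vec_commute[of "Z *v u" u])
    finally have "Re (cinner_vec u (lyapunov Z X *v u)) = 2 * l r * Re c" by simp
    then have "0 \<le> l r * Re c"
      using psdD[OF L, of u] by (simp add: complex_nonneg_Reals_iff mult.commute)
    moreover have "u \<noteq> 0" using u by auto
    then have "0 < Re c" using Z by (simp add: accretive_def c_def)
    ultimately show ?thesis by (simp add: zero_le_mult_iff)
  qed
  then show ?thesis by (rule psd_spectralI[OF XU])
qed

lemma psd_antisym:
  assumes "psd X" "psd (- X)"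
  shows "X = 0"
  using psd_norm_mono[of X 0] assms by simp

lemma psd_zero: "psd 0"
  by (simp add: psd_def)

text \<open>
  A Hermitian \<open>X\<close> in the kernel is positive semidefinite, and so is \<open>-X\<close>, by \<open>lyapunov_psd\<close>; the general
  case follows by splitting \<open>X\<close> into Hermitian and skew-Hermitian parts.
\<close>

lemma lyapunov_kernel:
  assumes Z: "accretive Z" and X: "lyapunov Z X = 0"
  shows "X = 0"
proof -
  note lin = clinear_map_imp_linear[OF clinear_map_lyapunov[of Z]]
  have herm: "H = 0" if H: "hermitian H" "lyapunov Z H = 0" for H
  proof (rule psd_antisym)
    show "psd H" using lyapunov_psd[OF Z H(1)] H(2) psd_zero by simp
    have "hermitian (- H)"
      using H(1) conj_transpose_diff[of 0 H] conj_transpose_diff[of H H] by (simp add: hermitian_def)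
    moreover have "lyapunov Z (- H) = 0" using linear_neg[OF lin] H(2) by simp
    ultimately show "psd (- H)" using lyapunov_psd[OF Z, of "- H"] psd_zero by simp
  qed
  have X': "lyapunov Z (conj_transpose X) = 0"
    using conj_transpose_lyapunov[of Z X] conj_transpose_diff[of X X] by (simp add: X)
  have "X + conj_transpose X = 0"
    by (rule herm)
      (simp_all add: hermitian_def conj_transpose_add conj_transpose_conj_transpose add.commute
        linear_add[OF lin] X X')
  moreover have "mscale \<i> (X - conj_transpose X) = 0"
  proof (rule herm)
    show "hermitian (mscale \<i> (X - conj_transpose X))"
      by (simp add: hermitian_def vec_eq_iff conj_transpose_nth mscale_nth algebra_simps)
    have "lyapunov Z (X - conj_transpose X) = 0" by (simp add: linear_diff[OF lin] X X')
    then show "lyapunov Z (mscale \<i> (X - conj_transpose X)) = 0"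
      by (simp add: clinear_map_mscale[OF clinear_map_lyapunov] mscale_zero)
  qed
  then have "X - conj_transpose X = 0" by (simp add: vec_eq_iff mscale_nth)
  ultimately have "2 *\<^sub>R X = 0" by (simp add: scaleR_2)
  then show "X = 0" by simp
qed

lemma bij_if_trivial_kernel:
  fixes f :: "'a::euclidean_space \<Rightarrow> 'a"
  assumes "linear f" "\<And>x. f x = 0 \<Longrightarrow> x = 0"
  shows "bij f"
proof -
  have "inj f" using assms linear_injective_0 by blast
  then show ?thesis using assms(1) linear_injective_imp_surjective by (auto simp: bij_def)
qed

lemma bij_lyapunov: "accretive Z \<Longrightarrow> bij (lyapunov Z)"
  using bij_if_trivial_kernel[OF clinear_map_imp_linear[OF clinear_map_lyapunov]] lyapunov_kernel
  by blast

text \<open>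
  This is \<open>1 \<otimes> Z\<close>.  On Choi matrices, composition with the Lyapunov map of \<open>Z\<close> is the Lyapunov map
  of \<open>1 \<otimes> Z\<close>, so statements about Choi matrices reduce to \<open>lyapunov_psd\<close> in a larger dimension.
\<close>

definition amplification :: "complex^'n^'n \<Rightarrow> complex^('n \<times> 'n)^('n \<times> 'n)"
  where "amplification Z = (\<chi> a b. if fst a = fst b then Z $ snd a $ snd b else 0)"

lemma sum_amplification_left:
  "(\<Sum>c\<in>UNIV. amplification Z $ (j, p) $ c * f c) = (\<Sum>r\<in>UNIV. Z $ p $ r * f (j, r))"
proof -
  have "(\<Sum>c\<in>UNIV. amplification Z $ (j, p) $ c * f c) =
      (\<Sum>i\<in>UNIV. if j = i then \<Sum>r\<in>UNIV. Z $ p $ r * f (i, r) else 0)"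
    unfolding sum_UNIV_prod by (rule sum.cong) (simp_all add: amplification_def)
  then show ?thesis by simp
qed

lemma accretive_amplification:
  fixes Z :: "complex^'n^'n"
  assumes "accretive Z"
  shows "accretive (amplification Z)"
  unfolding accretive_def
proof (intro allI impI)
  fix v :: "complex^('n \<times> 'n)"
  assume "v \<noteq> 0"
  define w :: "'n \<Rightarrow> complex^'n" where "w j = (\<chi> p. v $ (j, p))" for j
  have "cinner_vec v (amplification Z *v v) = (\<Sum>j\<in>UNIV. cinner_vec (w j) (Z *v w j))"
    by (simp add: cinner_vec_def matrix_vector_mult_def sum_UNIV_prod[of "\<lambda>a. cnj (v $ a) * _ a"]
        sum_amplification_left w_def)
  then have eq: "Re (cinner_vec v (amplification Z *v v)) = (\<Sum>j\<in>UNIV. Re (cinner_vec (w j) (Z *v w j)))"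
    by simp
  obtain j where "w j \<noteq> 0"
    using \<open>v \<noteq> 0\<close> by (auto simp: w_def vec_eq_iff)
  have pos: "w i \<noteq> 0 \<Longrightarrow> 0 < Re (cinner_vec (w i) (Z *v w i))" for i
    using assms by (simp add: accretive_def)
  have "0 \<le> Re (cinner_vec (w i) (Z *v w i))" for i
    using pos[of i] by (cases "w i = 0") simp_all
  then show "0 < Re (cinner_vec v (amplification Z *v v))"
    unfolding eq using pos[OF \<open>w j \<noteq> 0\<close>] by (intro sum_pos2[of _ j]) auto
qed

lemma choi_lyapunov_compose: "choi (\<lambda>A. lyapunov Z (\<phi> A)) = lyapunov (amplification Z) (choi \<phi>)"
proof -
  have "(amplification Z ** choi \<phi>) $ (j, p) $ b = (Z ** \<phi> (matrix_unit j (fst b))) $ p $ snd b" for j p b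
    by (simp add: matrix_matrix_mult_def sum_amplification_left choi_nth)
  moreover have "(choi \<phi> ** conj_transpose (amplification Z)) $ b $ (k, q) =
      (\<phi> (matrix_unit (fst b) k) ** conj_transpose Z) $ snd b $ q" for k q b
  proof -
    have "(choi \<phi> ** conj_transpose (amplification Z)) $ b $ (k, q) =
        cnj (\<Sum>c\<in>UNIV. amplification Z $ (k, q) $ c * cnj (choi \<phi> $ b $ c))"
      by (simp add: matrix_matrix_mult_def conj_transpose_nth mult.commute)
    also have "\<dots> = (\<phi> (matrix_unit (fst b) k) ** conj_transpose Z) $ snd b $ q"
      unfolding sum_amplification_left
      by (simp add: matrix_matrix_mult_def conj_transpose_nth choi_nth mult.commute)
    finally show ?thesis .
  qed
  ultimately show ?thesis
    by (simp add: vec_eq_iff split_paired_all lyapunov_def choi_nth)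
qed

definition diagonal_vector :: "complex^('n::finite \<times> 'n)"
  where "diagonal_vector = (\<chi> a. if fst a = snd a then 1 else 0)"

definition outer :: "complex^'m \<Rightarrow> complex^'m^'m"
  where "outer x = (\<chi> a b. x $ a * cnj (x $ b))"

lemma outer_nth: "outer x $ a $ b = x $ a * cnj (x $ b)"
  by (simp add: outer_def)

lemma quadratic_form_outer: "cinner_vec y (outer x *v y) = of_real ((cmod (cinner_vec x y))\<^sup>2)"
proof -
  have "cinner_vec y (outer x *v y) = cnj (cinner_vec x y) * cinner_vec x y"
    unfolding cinner_vec_matrix by (simp add: outer_nth cinner_vec_def sum_product mult_ac)
  then show ?thesis by (simp only: complex_norm_square mult.commute)
qed

lemma psd_outer: "psd (outer x)"
  by (simp add: psd_def quadratic_form_outer del: of_real_power)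

lemma choi_id: "choi (\<lambda>A. A) = outer diagonal_vector"
  by (auto simp: vec_eq_iff choi_nth outer_nth diagonal_vector_def matrix_unit_nth)

text \<open>
  The Choi matrix of the inverse is the solution of a Lyapunov equation whose right hand side is the
  Choi matrix of the identity map.  By uniqueness the solution is Hermitian, and since the right hand
  side is positive semidefinite, so is the solution.
\<close>

theorem completely_positive_inv_lyapunov:
  assumes Z: "accretive Z"
  shows "completely_positive (inv (lyapunov Z))"
proof -
  let ?X = "choi (inv (lyapunov Z))" and ?Z = "amplification Z"
  note amp = accretive_amplification[OF Z]
  have "lyapunov ?Z ?X = choi (\<lambda>A. lyapunov Z (inv (lyapunov Z) A))"
    by (rule choi_lyapunov_compose[symmetric])
  also have "\<dots> = outer diagonal_vector"
    using bij_lyapunov[OF Z] by (simp add: bij_is_surj surj_f_inv_f choi_id)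
  finally have L: "lyapunov ?Z ?X = outer diagonal_vector" .
  have "lyapunov ?Z (conj_transpose ?X) = lyapunov ?Z ?X"
    using psd_imp_hermitian[OF psd_outer[of diagonal_vector]]
    by (simp add: conj_transpose_lyapunov[symmetric] L hermitian_def)
  then have "hermitian ?X"
    using bij_lyapunov[OF amp] by (simp add: hermitian_def bij_is_inj inj_eq)
  then have "psd ?X" using lyapunov_psd[OF amp, of ?X] L psd_outer[of diagonal_vector] by simp
  then show ?thesis
    using clinear_map_inv[OF clinear_map_lyapunov bij_lyapunov[OF Z]]
    by (rule psd_choi_imp_completely_positive[rotated])
qed

section \<open>Resolvents of inverses\<close>

text \<open>
  The map \<open>\<psi> + t\<close>, whose inverse is the resolvent of \<open>\<psi>\<^sup>-\<^sup>1\<close> at \<open>t\<close>.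
\<close>

definition shift :: "real \<Rightarrow> (complex^'n^'n \<Rightarrow> complex^'n^'n) \<Rightarrow> complex^'n^'n \<Rightarrow> complex^'n^'n"
  where "shift t \<psi> A = \<psi> A + t *\<^sub>R A"

lemma clinear_map_shift: "clinear_map \<psi> \<Longrightarrow> clinear_map (shift t \<psi>)"
  unfolding shift_def by (intro clinear_map_plus clinear_map_scaleR_left clinear_map_id)

lemma shift_shift: "shift t (shift s \<psi>) = shift (s + t) \<psi>"
  by (rule ext) (simp add: shift_def algebra_simps)

lemma shift_0: "shift 0 \<psi> = \<psi>"
  by (rule ext) (simp add: shift_def)

lemma resolvent_inv:
  assumes "bij \<psi>" "bij (shift t \<psi>)"
  shows "resolvent t (inv \<psi>) = inv (shift t \<psi>)"
proof -
  have "(\<lambda>A. A + t *\<^sub>R inv \<psi> A) = shift t \<psi> \<circ> inv \<psi>"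
    using assms(1) by (auto simp: shift_def bij_is_surj surj_f_inv_f)
  then have "inv (\<lambda>A. A + t *\<^sub>R inv \<psi> A) = \<psi> \<circ> inv (shift t \<psi>)"
    using assms by (simp add: o_inv_distrib bij_imp_bij_inv inv_inv_eq)
  then show ?thesis
    using assms(1) by (simp add: resolvent_def fun_eq_iff bij_is_inj inv_f_f)
qed

lemma eigenvalue_if_kernel:
  assumes "t > 0" "A + t *\<^sub>R \<theta> A = 0" "A \<noteq> 0"
  shows "\<exists>r<0. is_eigenvalue \<theta> (of_real r)"
proof -
  have "t *\<^sub>R \<theta> A = - A" using assms(2) by (simp add: add_eq_0_iff)
  then have "(1 / t) *\<^sub>R t *\<^sub>R \<theta> A = (1 / t) *\<^sub>R (- A)" by simp
  then have "\<theta> A = mscale (of_real (- 1 / t)) A"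
    using assms(1) unfolding mscale_of_real by simp
  then have "is_eigenvalue \<theta> (of_real (- 1 / t))"
    unfolding is_eigenvalue_def using assms(3) by blast
  then show ?thesis using assms(1) by (intro exI[of _ "- 1 / t"]) simp
qed

lemma q_positive_bij:
  assumes "q_positive \<theta>" "t \<ge> 0"
  shows "bij (\<lambda>A. A + t *\<^sub>R \<theta> A)"
proof (rule bij_if_trivial_kernel)
  have lin: "clinear_map \<theta>" using assms(1) by (simp add: q_positive_def)
  show "linear (\<lambda>A. A + t *\<^sub>R \<theta> A)"
    by (intro clinear_map_imp_linear clinear_map_plus clinear_map_scaleR_left clinear_map_id lin)
  show "A = 0" if "A + t *\<^sub>R \<theta> A = 0" for A
  proof (cases "t = 0")
    case False
    then show ?thesis
      using assms that eigenvalue_if_kernel[of t A \<theta>] by (auto simp: q_positive_def)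
  qed (use that in simp)
qed

lemma bij_shift_if_q_positive_inv:
  assumes "bij \<psi>" "q_positive (inv \<psi>)" "t \<ge> 0"
  shows "bij (shift t \<psi>)"
proof -
  have "shift t \<psi> = (\<lambda>A. A + t *\<^sub>R inv \<psi> A) \<circ> \<psi>"
    using assms(1) by (simp add: fun_eq_iff shift_def bij_is_inj inv_f_f)
  then show ?thesis
    using q_positive_bij[OF assms(2,3)] assms(1) by (simp add: bij_comp)
qed

text \<open>
  Both conditions on \<open>\<psi>\<^sup>-\<^sup>1\<close> concern the maps \<open>\<psi> + t\<close>: a negative eigenvalue \<open>r\<close> of \<open>\<psi>\<^sup>-\<^sup>1\<close> is the same as
  a kernel of \<open>\<psi> + t\<close> for \<open>t = -1/r\<close>.
\<close>

lemma q_positive_inv_iff: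
  assumes lin: "clinear_map \<psi>" and bij: "bij \<psi>"
  shows "q_positive (inv \<psi>) \<longleftrightarrow>
    (\<forall>t\<ge>0. bij (shift t \<psi>) \<and> completely_positive (inv (shift t \<psi>)))"
proof
  assume L: "q_positive (inv \<psi>)"
  show "\<forall>t\<ge>0. bij (shift t \<psi>) \<and> completely_positive (inv (shift t \<psi>))"
  proof (intro allI impI)
    fix t :: real assume t: "t \<ge> 0"
    have b: "bij (shift t \<psi>)" by (rule bij_shift_if_q_positive_inv[OF bij L t])
    have "completely_positive (resolvent t (inv \<psi>))"
      using L t by (simp add: q_positive_def)
    with b show "bij (shift t \<psi>) \<and> completely_positive (inv (shift t \<psi>))"
      by (simp add: resolvent_inv[OF bij b])
  qed
next
  assume R: "\<forall>t\<ge>0. bij (shift t \<psi>) \<and> completely_positive (inv (shift t \<psi>))"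
  have "\<not> is_eigenvalue (inv \<psi>) (of_real r)" if r: "r < 0" for r
  proof
    assume "is_eigenvalue (inv \<psi>) (of_real r)"
    then obtain A where A: "A \<noteq> 0" "inv \<psi> A = r *\<^sub>R A"
      by (auto simp: is_eigenvalue_def mscale_of_real)
    have "A = \<psi> (inv \<psi> A)" using bij by (simp add: bij_is_surj surj_f_inv_f)
    then have "A = r *\<^sub>R \<psi> A" using A(2) clinear_map_scaleR[OF lin] by simp
    then have "(1 / r) *\<^sub>R A = (1 / r) *\<^sub>R (r *\<^sub>R \<psi> A)" by simp
    then have "shift (- 1 / r) \<psi> A = 0" using r by (simp add: shift_def)
    moreover have "shift (- 1 / r) \<psi> 0 = 0"
      using linear_0[OF clinear_map_imp_linear[OF clinear_map_shift[OF lin]]] .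
    moreover have "bij (shift (- 1 / r) \<psi>)" using R r by simp
    ultimately show False using A(1) by (metis bij_is_inj injD)
  qed
  moreover have "completely_positive (resolvent t (inv \<psi>))" if "t \<ge> 0" for t
    using R that resolvent_inv[OF bij] by simp
  ultimately show "q_positive (inv \<psi>)"
    using clinear_map_inv[OF lin bij] by (simp add: q_positive_def)
qed

text \<open>
  This is \<open>P\<^sup>-\<^sup>1 - Q\<^sup>-\<^sup>1 = P\<^sup>-\<^sup>1 (Q - P) Q\<^sup>-\<^sup>1\<close>, a composition of completely positive maps.
\<close>

lemma completely_positive_inverse_difference:
  assumes "bij P" "bij Q" "clinear_map P" "clinear_map Q"
    and "completely_positive (inv P)" "completely_positive (inv Q)"
    and "completely_positive (\<lambda>A. Q A - P A)"
  shows "completely_positive (\<lambda>A. inv P A - inv Q A)"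
proof -
  have "inv P A - inv Q A = inv P (Q (inv Q A) - P (inv Q A))" for A
  proof -
    have "inv P (Q (inv Q A) - P (inv Q A)) = inv P (Q (inv Q A)) - inv P (P (inv Q A))"
      by (rule linear_diff[OF clinear_map_imp_linear[OF clinear_map_inv]]) (use assms in auto)
    then show ?thesis
      using assms(1,2) by (simp add: bij_is_surj surj_f_inv_f bij_is_inj inv_f_f)
  qed
  moreover have "completely_positive (\<lambda>A. inv P (Q (inv Q A) - P (inv Q A)))"
    by (rule completely_positive_compose[OF assms(5) completely_positive_compose[OF assms(7,6)]])
  ultimately show ?thesis by simp
qed

lemma q_subordinate_inv:
  assumes lin: "clinear_map \<psi>" "clinear_map \<eta>" and bij: "bij \<psi>" "bij \<eta>"
    and q: "q_positive (inv \<psi>)" "q_positive (inv \<eta>)"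
    and cp: "completely_positive (\<lambda>A. \<eta> A - \<psi> A)"
  shows "q_subordinate (inv \<eta>) (inv \<psi>)"
proof -
  have "completely_positive (\<lambda>A. resolvent t (inv \<psi>) A - resolvent t (inv \<eta>) A)"
    if t: "t \<ge> 0" for t
  proof -
    have s: "bij (shift t \<psi>)" "completely_positive (inv (shift t \<psi>))"
      "bij (shift t \<eta>)" "completely_positive (inv (shift t \<eta>))"
      using q_positive_inv_iff[OF lin(1) bij(1)] q_positive_inv_iff[OF lin(2) bij(2)] q t by auto
    have "(\<lambda>A. shift t \<eta> A - shift t \<psi> A) = (\<lambda>A. \<eta> A - \<psi> A)"
      by (simp add: shift_def)
    then have "completely_positive (\<lambda>A. inv (shift t \<psi>) A - inv (shift t \<eta>) A)"
      using s lin cp by (intro completely_positive_inverse_difference clinear_map_shift) auto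
    then show ?thesis by (simp add: resolvent_inv bij s)
  qed
  with q show ?thesis by (simp add: q_subordinate_def)
qed

lemma q_subordinate_resolvent:
  assumes lin: "clinear_map \<psi>" and bij: "bij \<psi>" and q: "q_positive (inv \<psi>)" and s: "s \<ge> 0"
  shows "q_subordinate (resolvent s (inv \<psi>)) (inv \<psi>)"
proof -
  have b: "bij (shift s \<psi>)" by (rule bij_shift_if_q_positive_inv[OF bij q s])
  have "q_positive (inv (shift s \<psi>))"
    using q s unfolding q_positive_inv_iff[OF lin bij] q_positive_inv_iff[OF clinear_map_shift[OF lin] b]
    by (simp add: shift_shift)
  moreover have "completely_positive (\<lambda>A. shift s \<psi> A - \<psi> A)"
    unfolding shift_def using completely_positive_scaleR[OF completely_positive_id s] by simp
  ultimately show ?thesis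
    unfolding resolvent_inv[OF bij b]
    using lin bij q b by (intro q_subordinate_inv clinear_map_shift) auto
qed

lemma q_positive_zero: "q_positive (\<lambda>_ :: complex^'n^'n. 0)"
  by (auto simp: q_positive_def is_eigenvalue_def resolvent_def comp_def completely_positive_zero
      completely_positive_clinear mscale_of_real simp del: of_real_eq_0_iff)

lemma q_subordinate_zero: "q_positive \<phi> \<Longrightarrow> q_subordinate (\<lambda>_. 0) \<phi>"
  by (simp add: q_subordinate_def q_positive_zero) (simp add: resolvent_def q_positive_def comp_def)

section \<open>Asymptotics of resolvents\<close>

text \<open>
  Let \<open>B\<^sub>t = (\<psi> + t)\<^sup>-\<^sup>1 A\<close>.  As \<open>\<psi>\<close> is bounded, the equation \<open>t B\<^sub>t = A - \<psi> B\<^sub>t\<close> forces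
  \<open>B\<^sub>t = O(1/t)\<close>; reading it again gives \<open>t B\<^sub>t \<rightarrow> A\<close>, and multiplied by \<open>t\<close> it gives the second order.
\<close>

lemma
  assumes lin: "clinear_map \<psi>" and bij: "\<And>t. t \<ge> 0 \<Longrightarrow> bij (shift t \<psi>)"
  shows resolvent_first_order: "((\<lambda>t. t *\<^sub>R inv (shift t \<psi>) A) \<longlongrightarrow> A) at_top"
    and resolvent_second_order: "((\<lambda>t. t\<^sup>2 *\<^sub>R inv (shift t \<psi>) A - t *\<^sub>R A) \<longlongrightarrow> - \<psi> A) at_top"
proof -
  define B where "B t = inv (shift t \<psi>) A" for t
  have lin': "linear \<psi>" by (rule clinear_map_imp_linear[OF lin])
  then have bl: "bounded_linear \<psi>" by (simp add: linear_conv_bounded_linear)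
  obtain K where K: "K > 0" "\<And>x. norm (\<psi> x) \<le> K * norm x"
    using linear_bounded_pos[OF lin'] by blast
  have eq: "\<psi> (B t) = A - t *\<^sub>R B t" if "t \<ge> 0" for t
  proof -
    have "shift t \<psi> (B t) = A"
      unfolding B_def using bij[OF that] by (simp add: bij_is_surj surj_f_inv_f)
    then show ?thesis by (simp add: shift_def algebra_simps)
  qed
  have bound: "norm (B t) \<le> 2 * norm A / t" if t: "t > 0" "t \<ge> 2 * K" for t
  proof -
    have "t * norm (B t) = norm (A - \<psi> (B t))" using eq[of t] t by simp
    also have "\<dots> \<le> norm A + K * norm (B t)"
      using norm_triangle_ineq4[of A "\<psi> (B t)"] K(2)[of "B t"] by linarith
    also have "K * norm (B t) \<le> t / 2 * norm (B t)"
      using t by (intro mult_right_mono) auto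
    finally show ?thesis using t by (simp add: field_simps)
  qed
  have "((\<lambda>t. 2 * norm A / t) \<longlongrightarrow> 0) at_top"
    by (intro tendsto_divide_0[OF tendsto_const] filterlim_at_top_imp_at_infinity filterlim_ident)
  moreover have "eventually (\<lambda>t. norm (B t) \<le> 2 * norm A / t) at_top"
    using eventually_gt_at_top[of 0] eventually_ge_at_top[of "2 * K"]
    by eventually_elim (rule bound)
  ultimately have B0: "(B \<longlongrightarrow> 0) at_top"
    by (intro Lim_null_comparison[of B "\<lambda>t. 2 * norm A / t"])
  have "((\<lambda>t. \<psi> (B t)) \<longlongrightarrow> \<psi> 0) at_top"
    by (rule bounded_linear.tendsto[OF bl B0])
  then have "((\<lambda>t. A - \<psi> (B t)) \<longlongrightarrow> A - 0) at_top"
    unfolding linear_0[OF lin'] by (intro tendsto_diff tendsto_const)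
  moreover have ev: "eventually (\<lambda>t. A - \<psi> (B t) = t *\<^sub>R B t) at_top"
    using eventually_ge_at_top[of 0] by eventually_elim (simp add: eq)
  ultimately have first: "((\<lambda>t. t *\<^sub>R B t) \<longlongrightarrow> A) at_top"
    using tendsto_cong[OF ev] by simp
  then show "((\<lambda>t. t *\<^sub>R inv (shift t \<psi>) A) \<longlongrightarrow> A) at_top" by (simp add: B_def)
  have "((\<lambda>t. - \<psi> (t *\<^sub>R B t)) \<longlongrightarrow> - \<psi> A) at_top"
    by (intro tendsto_minus bounded_linear.tendsto[OF bl first])
  moreover have "eventually (\<lambda>t. - \<psi> (t *\<^sub>R B t) = t\<^sup>2 *\<^sub>R B t - t *\<^sub>R A) at_top"
    using eventually_ge_at_top[of 0]
    by eventually_elim (simp add: linear_cmul[OF lin'] eq power2_eq_square algebra_simps)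
  ultimately show "((\<lambda>t. t\<^sup>2 *\<^sub>R inv (shift t \<psi>) A - t *\<^sub>R A) \<longlongrightarrow> - \<psi> A) at_top"
    unfolding B_def[symmetric] using tendsto_cong by force
qed

lemma choi_scaleR: "choi (\<lambda>A. t *\<^sub>R f A) = t *\<^sub>R choi f"
  by (simp add: vec_eq_iff choi_nth)

lemma choi_uminus: "choi (\<lambda>A. - f A) = - choi f"
  by (simp add: vec_eq_iff choi_nth)

lemma resolvent_choi_second_order:
  assumes "clinear_map \<psi>" "bij \<psi>" "q_positive (inv \<psi>)"
  shows "((\<lambda>t. t\<^sup>2 *\<^sub>R choi (inv (shift t \<psi>)) - t *\<^sub>R outer diagonal_vector) \<longlongrightarrow> - choi \<psi>) at_top"
proof -
  have b: "bij (shift t \<psi>)" if "t \<ge> 0" for t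
    by (rule bij_shift_if_q_positive_inv[OF assms(2,3) that])
  have "((\<lambda>t. choi (\<lambda>A. t\<^sup>2 *\<^sub>R inv (shift t \<psi>) A - t *\<^sub>R A)) \<longlongrightarrow> choi (\<lambda>A. - \<psi> A)) at_top"
    using resolvent_second_order[OF assms(1) b] by (intro tendsto_choi) auto
  then show ?thesis
    by (simp add: choi_diff choi_scaleR choi_uminus choi_id)
qed

section \<open>Conditional positivity\<close>

lemma closed_hermitian: "closed {H :: complex^'m^'m. hermitian H}"
proof -
  have "{H :: complex^'m^'m. hermitian H} = {H. \<forall>a b. cnj (H $ b $ a) = H $ a $ b}"
    by (auto simp: hermitian_def vec_eq_iff conj_transpose_nth)
  then show ?thesis
    by (auto intro!: closed_Collect_all closed_Collect_eq continuous_intros)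
qed

lemma matrix_vector_mult_diff_left: "(A - B) *v x = A *v x - B *v (x :: complex^'m)"
  by (simp add: vec_eq_iff matrix_vector_mult_def algebra_simps sum_subtractf)

text \<open>
  Both claims are inherited from \<open>t\<^sup>2 (\<psi> + t)\<^sup>-\<^sup>1 - t\<close>, which converges to \<open>-\<psi>\<close>: its Choi matrix is Hermitian,
  and the subtracted multiple of \<open>\<Omega> \<Omega>\<^sup>*\<close> vanishes on vectors orthogonal to \<open>\<Omega>\<close>.
\<close>

lemma
  fixes \<psi> :: "complex^'n^'n \<Rightarrow> complex^'n^'n"
  assumes lin: "clinear_map \<psi>" and bij: "bij \<psi>" and q: "q_positive (inv \<psi>)"
  shows hermitian_choi_generator: "hermitian (- choi \<psi>)"
    and generator_conditionally_positive: "\<And>x. cinner_vec diagonal_vector x = 0 \<Longrightarrow>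
      cinner_vec x (- choi \<psi> *v x) \<in> \<real>\<^sub>\<ge>\<^sub>0"
proof -
  define M :: "real \<Rightarrow> complex^('n \<times> 'n)^('n \<times> 'n)"
    where "M t = t\<^sup>2 *\<^sub>R choi (inv (shift t \<psi>)) - t *\<^sub>R outer diagonal_vector" for t
  have lim: "(M \<longlongrightarrow> - choi \<psi>) at_top"
    using resolvent_choi_second_order[OF assms] by (simp add: M_def[abs_def])
  have psd: "psd (choi (inv (shift t \<psi>)))" if "t \<ge> 0" for t
    using q_positive_inv_iff[OF lin bij] q that by (simp add: completely_positive_imp_psd_choi)
  have "hermitian (M t)" if "t \<ge> 0" for t
    using hermitian_entry[OF psd_imp_hermitian[OF psd[OF that]]]
      hermitian_entry[OF psd_imp_hermitian[OF psd_outer[of "diagonal_vector :: complex^('n \<times> 'n)"]]]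
    by (simp add: hermitian_def vec_eq_iff conj_transpose_nth M_def)
  then have "eventually (\<lambda>t. M t \<in> {H. hermitian H}) at_top"
    by (auto intro: eventually_mono[OF eventually_ge_at_top[of 0]])
  then show "hermitian (- choi \<psi>)"
    using Lim_in_closed_set[OF closed_hermitian _ _ lim] by simp
  show "cinner_vec x (- choi \<psi> *v x) \<in> \<real>\<^sub>\<ge>\<^sub>0" if x: "cinner_vec diagonal_vector x = 0" for x
  proof (rule Lim_in_closed_set[OF closed_nonneg_Reals_complex _ _ tendsto_quadratic_form[OF lim]])
    have "cinner_vec x (M t *v x) \<in> \<real>\<^sub>\<ge>\<^sub>0" if "t \<ge> 0" for t
    proof -
      have "cinner_vec x (M t *v x) = of_real (t\<^sup>2) * cinner_vec x (choi (inv (shift t \<psi>)) *v x)"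
        by (simp add: M_def matrix_vector_mult_diff_left cinner_vec_diff_right scaleR_matrix_vector
          cinner_vec_scale_right quadratic_form_outer x)
      also have "\<dots> \<in> \<real>\<^sub>\<ge>\<^sub>0"
        by (intro nonneg_Reals_mult_I psdD[OF psd[OF that]]) (simp del: of_real_power)
      finally show ?thesis .
    qed
    then show "eventually (\<lambda>t. cinner_vec x (M t *v x) \<in> \<real>\<^sub>\<ge>\<^sub>0) at_top"
      by (auto intro: eventually_mono[OF eventually_ge_at_top[of 0]])
  qed simp
qed

text \<open>
  For \<open>w\<^sub>c = 1\<close> this is \<open>(1 - w e\<^sub>c\<^sup>*) N (1 - e\<^sub>c w\<^sup>*)\<close>.  The oblique projection \<open>1 - e\<^sub>c w\<^sup>*\<close> onto the
  orthogonal complement of \<open>w\<close>, rather than the orthogonal one, kills the basis vector \<open>e\<^sub>c\<close>, so that the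
  row and the column with index \<open>c\<close> of the compressed matrix vanish.
\<close>

definition compress :: "complex^'m \<Rightarrow> 'm \<Rightarrow> complex^'m^'m \<Rightarrow> complex^'m^'m"
  where "compress w c N =
    (\<chi> a b. N $ a $ b - w $ a * N $ c $ b - N $ a $ c * cnj (w $ b) + w $ a * N $ c $ c * cnj (w $ b))"

lemma psd_compress:
  fixes N :: "complex^'m^'m"
  assumes wc: "w $ c = 1"
    and N: "\<And>x. cinner_vec w x = 0 \<Longrightarrow> cinner_vec x (N *v x) \<in> \<real>\<^sub>\<ge>\<^sub>0"
  shows "psd (compress w c N)"
  unfolding psd_def
proof
  fix x
  define s where "s = cinner_vec w x"
  define e :: "complex^'m" where "e = axis c 1"
  have eq: "compress w c N *v x = N *v x - (N *v x) $ c *s w - s *s (N *v e) + (s * N $ c $ c) *s w"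
  proof -
    have "(compress w c N *v x) $ a = (\<Sum>b\<in>UNIV. N $ a $ b * x $ b) - (\<Sum>b\<in>UNIV. N $ c $ b * x $ b) * w $ a
      - s * N $ a $ c + s * N $ c $ c * w $ a" for a
      by (simp add: matrix_vector_mult_def compress_def s_def cinner_vec_def algebra_simps
          sum.distrib sum_subtractf sum_distrib_left)
    then show ?thesis
      by (simp add: vec_eq_iff matrix_vector_mult_axis e_def) (simp add: matrix_vector_mult_def)
  qed
  have "cinner_vec x w = cnj s" by (simp add: s_def cinner_vec_commute[of x w])
  then have "cinner_vec x (compress w c N *v x) =
      cinner_vec (x - s *s e) (N *v (x - s *s e))"
    unfolding eq
    by (simp add: cinner_vec_diff_right cinner_vec_add_right cinner_vec_diff_left cinner_vec_scale_right
        cinner_vec_scale_left matrix_vector_mult_diff_distrib matrix_vector_mult_smult e_def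
        cinner_vec_axis matrix_vector_mult_axis algebra_simps)
  moreover have "cinner_vec w (x - s *s e) = 0"
    by (simp add: cinner_vec_diff_right cinner_vec_scale_right e_def cinner_vec_axis_right wc s_def)
  ultimately show "cinner_vec x (compress w c N *v x) \<in> \<real>\<^sub>\<ge>\<^sub>0" using N by simp
qed

text \<open>
  A vector at which a nonnegative form vanishes minimises it, so the derivative of the form there is
  zero; the direction \<open>D x\<close> suffices to see this.
\<close>

lemma psd_kernel:
  fixes D :: "complex^'m^'m"
  assumes D: "psd D" and x: "Re (cinner_vec x (D *v x)) = 0"
  shows "D *v x = 0"
proof -
  define z where "z = D *v x"
  have sym: "u \<bullet> (D *v v) = (D *v u) \<bullet> v" for u v
    using psd_imp_hermitian[OF D] by (metis Re_cinner_vec cinner_vec_adjoint hermitian_def)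
  note lin = linear_matrix_vector_mult_complex[of D]
  have "z \<bullet> z = 0"
  proof (rule nonneg_quadratic_imp_linear_coeff_zero)
    fix t :: real
    have "0 \<le> (x + t *\<^sub>R z) \<bullet> (D *v (x + t *\<^sub>R z))"
      using psdD[OF D, of "x + t *\<^sub>R z"] by (simp add: complex_nonneg_Reals_iff Re_cinner_vec)
    moreover have "x \<bullet> z = 0" using x by (simp add: z_def Re_cinner_vec)
    moreover have "x \<bullet> (D *v z) = z \<bullet> z" using sym[of x z] by (simp add: z_def)
    ultimately show "0 \<le> 2 * t * (z \<bullet> z) + t\<^sup>2 * (z \<bullet> (D *v z))"
      by (simp add: linear_add[OF lin] linear_cmul[OF lin] z_def[symmetric] inner_add_left
        inner_add_right power2_eq_square algebra_simps)
  qed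
  then show ?thesis by (simp add: z_def)
qed

text \<open>
  A nonnegative form that is nonpositive on the orthogonal complement of \<open>w\<close> vanishes there, so this
  complement lies in the kernel of \<open>D\<close>.
  A Hermitian matrix with this kernel is determined by its entry at \<open>(c, c)\<close>.
\<close>

lemma psd_rank_one:
  fixes D :: "complex^'m^'m"
  assumes D: "psd D" and wc: "w $ c = 1"
    and neg: "\<And>x. cinner_vec w x = 0 \<Longrightarrow> Re (cinner_vec x (D *v x)) \<le> 0"
  shows "\<exists>s\<ge>0. D = s *\<^sub>R outer w"
proof -
  have ker: "D *v x = 0" if "cinner_vec w x = 0" for x
  proof (rule psd_kernel[OF D])
    show "Re (cinner_vec x (D *v x)) = 0"
      using neg[OF that] psdD[OF D, of x] by (simp add: complex_nonneg_Reals_iff)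
  qed
  have col: "D $ a $ b = cnj (w $ b) * D $ a $ c" for a b
  proof -
    have "D *v (axis b 1 - cnj (w $ b) *s axis c 1) = 0"
      by (rule ker) (simp add: cinner_vec_diff_right cinner_vec_scale_right cinner_vec_axis_right wc)
    then have "(D *v axis b 1) $ a - cnj (w $ b) * (D *v axis c 1) $ a = 0"
      by (simp add: matrix_vector_mult_diff_distrib matrix_vector_mult_smult vec_eq_iff)
    then show ?thesis by (simp add: matrix_vector_mult_axis)
  qed
  define s where "s = Re (D $ c $ c)"
  have s: "s \<ge> 0" "D $ c $ c = of_real s"
    using psd_diag[OF D, of c] by (simp_all add: s_def complex_nonneg_Reals_iff complex_eq_iff)
  have "D $ a $ c = w $ a * of_real s" for a
  proof -
    have "D $ a $ c = cnj (D $ c $ a)" using hermitian_entry[OF psd_imp_hermitian[OF D], of c a] by simp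
    also have "\<dots> = w $ a * of_real s" unfolding col[of c a] s(2) by simp
    finally show ?thesis .
  qed
  then have "D $ a $ b = cnj (w $ b) * (w $ a * of_real s)" for a b
    using col[of a b] by simp
  then have "D = s *\<^sub>R outer w"
    by (simp add: vec_eq_iff outer_nth scaleR_conv_of_real[where 'a = complex] mult_ac)
  with s(1) show ?thesis by blast
qed

lemma choi_lyapunov:
  "choi (lyapunov Y) $ a $ b = Y $ snd a $ fst a * diagonal_vector $ b + diagonal_vector $ a * cnj (Y $ snd b $ fst b)"
proof -
  have "(Y ** matrix_unit j k) $ p $ q = (\<Sum>r\<in>UNIV. if r = j then if q = k then Y $ p $ r else 0 else 0)" for j k p q
    unfolding matrix_matrix_mult_def vec_lambda_beta matrix_unit_nth by (rule sum.cong) auto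
  then have 1: "(Y ** matrix_unit j k) $ p $ q = (if k = q then Y $ p $ j else 0)" for j k p q
    by auto
  have "(matrix_unit j k ** conj_transpose Y) $ p $ q = (\<Sum>r\<in>UNIV. if r = k then if p = j then cnj (Y $ q $ r) else 0 else 0)" for j k p q
    unfolding matrix_matrix_mult_def vec_lambda_beta matrix_unit_nth conj_transpose_nth
    by (rule sum.cong) auto
  then have 2: "(matrix_unit j k ** conj_transpose Y) $ p $ q = (if j = p then cnj (Y $ q $ k) else 0)" for j k p q
    by auto
  show ?thesis by (simp add: choi_nth lyapunov_def 1 2 diagonal_vector_def)
qed

text \<open>
  With \<open>y\<close> the vector of entries of \<open>Y\<close>, the Choi matrix of the Lyapunov map is \<open>y \<Omega>\<^sup>* + \<Omega> y\<^sup>*\<close>.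
\<close>

lemma choi_lyapunov_conditionally_zero:
  assumes x: "cinner_vec diagonal_vector x = 0"
  shows "cinner_vec x (choi (lyapunov Y) *v x) = 0"
proof -
  define y where "y = (\<chi> a. Y $ snd a $ fst a)"
  have real: "cnj (diagonal_vector $ b) = diagonal_vector $ b" for b
    by (simp add: diagonal_vector_def)
  have "(choi (lyapunov Y) *v x) $ a = cinner_vec diagonal_vector x * y $ a + diagonal_vector $ a * cinner_vec y x" for a
    by (simp add: matrix_vector_mult_def choi_lyapunov cinner_vec_def y_def real algebra_simps sum.distrib
      sum_distrib_left)
  then have "choi (lyapunov Y) *v x = cinner_vec y x *s diagonal_vector"
    by (simp add: vec_eq_iff x)
  moreover have "cinner_vec x diagonal_vector = 0"
    using x cinner_vec_commute[of x diagonal_vector] by simp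
  ultimately show ?thesis by (simp add: cinner_vec_scale_right)
qed

lemma diagonal_vector_nth: "diagonal_vector $ (j, k) = (if j = k then 1 else 0)"
  by (simp add: diagonal_vector_def)

text \<open>
  The compression of the Choi matrix \<open>N\<close> of \<open>-\<psi>\<close> differs from \<open>N\<close> by a matrix of the form
  \<open>y \<Omega>\<^sup>* + \<Omega> y\<^sup>*\<close>, which is the Choi matrix of a Lyapunov map.  The vanishing entry at \<open>(c, c)\<close> normalises
  \<open>Y\<close>: it excludes that a multiple of the identity map is moved between the two summands.
\<close>

theorem lyapunov_dominates_generator:
  fixes \<psi> :: "complex^'n^'n \<Rightarrow> complex^'n^'n"
  assumes lin: "clinear_map \<psi>" and bij: "bij \<psi>" and q: "q_positive (inv \<psi>)"
  obtains Y where "completely_positive (\<lambda>A. lyapunov Y A - \<psi> A)"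
    "choi (\<lambda>A. lyapunov Y A - \<psi> A) $ (c, c) $ (c, c) = 0"
proof -
  define w :: "complex^('n \<times> 'n)" where "w = diagonal_vector"
  define N where "N = - choi \<psi>"
  \<comment> \<open>The term with the entry at \<open>(c, c)\<close> is halved because \<open>Y\<close> and \<open>Y\<^sup>*\<close> both contribute it.\<close>
  define Y where "Y = (\<chi> p j. (if j = p then N $ (c, c) $ (c, c) / 2 else 0) - N $ (j, p) $ (c, c))"
  have herm: "cnj (N $ b $ a) = N $ a $ b" for a b
    using hermitian_entry[OF hermitian_choi_generator[OF assms]] by (simp add: N_def)
  have wc: "w $ (c, c) = 1" by (simp add: w_def diagonal_vector_def)
  have "choi (\<lambda>A. lyapunov Y A - \<psi> A) = compress w (c, c) N"
  proof -
    have "choi (lyapunov Y) $ (j, p) $ (k, q) + N $ (j, p) $ (k, q) = compress w (c, c) N $ (j, p) $ (k, q)" for j p k q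
      by (auto simp: choi_lyapunov compress_def Y_def w_def diagonal_vector_nth herm field_simps)
    then show ?thesis
      by (simp add: vec_eq_iff split_paired_all choi_diff N_def)
  qed
  moreover have "psd (compress w (c, c) N)"
    by (rule psd_compress[OF wc]) (use generator_conditionally_positive[OF assms] in \<open>simp add: w_def N_def\<close>)
  moreover have "compress w (c, c) N $ (c, c) $ (c, c) = 0"
    by (simp add: compress_def wc)
  moreover have "clinear_map (\<lambda>A. lyapunov Y A - \<psi> A)"
    by (intro clinear_map_minus clinear_map_lyapunov lin)
  ultimately show thesis
    by (intro that[of Y] psd_choi_imp_completely_positive) simp_all
qed

section \<open>Pure maps have Lyapunov inverses\<close>

lemma lyapunov_one: "lyapunov Y (mat 1) = Y + conj_transpose Y"
  by (simp add: lyapunov_def)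

lemma cinner_vec_conj_transpose: "cinner_vec v (conj_transpose Y *v v) = cnj (cinner_vec v (Y *v v))"
  by (simp add: cinner_vec_adjoint[of v "conj_transpose Y"] conj_transpose_conj_transpose
      cinner_vec_commute[of "Y *v v" v])

lemma psd_completely_positive_one:
  fixes \<theta> :: "complex^'n^'n \<Rightarrow> complex^'n^'n"
  assumes "completely_positive \<theta>"
  shows "psd (\<theta> (mat 1))"
proof -
  have "block_positive 1 (\<lambda>_ _. mat 1 :: complex^'n^'n)"
    by (simp add: block_positive_def cinner_vec_self del: of_real_power)
  then have "block_positive 1 (\<lambda>_ _. \<theta> (mat 1))"
    using assms unfolding completely_positive_def by blast
  then have pos: "cinner_vec (x 0) (\<theta> (mat 1) *v x 0) \<in> \<real>\<^sub>\<ge>\<^sub>0" for x :: "nat \<Rightarrow> complex^'n"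
    by (simp add: block_positive_def)
  show ?thesis unfolding psd_def using pos[of "\<lambda>_. _"] by blast
qed

lemma shift_lyapunov:
  fixes Y :: "complex^'n^'n"
  shows "shift t (lyapunov Y) = lyapunov (Y + (t / 2) *\<^sub>R mat 1)"
proof
  fix A :: "complex^'n^'n"
  have "conj_transpose ((t / 2) *\<^sub>R mat 1 :: complex^'n^'n) = (t / 2) *\<^sub>R mat 1"
    by (simp add: vec_eq_iff conj_transpose_nth mat_def)
  moreover have "((t / 2) *\<^sub>R mat 1) ** A = (t / 2) *\<^sub>R A" "A ** ((t / 2) *\<^sub>R mat 1) = (t / 2) *\<^sub>R A"
    by (simp_all add: mscale_of_real[symmetric] mscale_mult)
  moreover have "(t / 2) *\<^sub>R A + (t / 2) *\<^sub>R A = t *\<^sub>R A" by (simp flip: scaleR_add_left)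
  ultimately show "shift t (lyapunov Y) A = lyapunov (Y + (t / 2) *\<^sub>R mat 1) A"
    by (simp add: shift_def lyapunov_def matrix_matrix_mult_add_rdistrib matrix_add_ldistrib
        conj_transpose_add algebra_simps)
qed

lemma q_positive_inv_lyapunov:
  assumes "accretive Y"
  shows "q_positive (inv (lyapunov Y))"
proof -
  have "accretive (Y + (t / 2) *\<^sub>R mat 1)" if "t \<ge> 0" for t
    using assms that unfolding accretive_def
    by (auto simp: matrix_vector_mult_add_rdistrib scaleR_matrix_vector cinner_vec_add_right
        cinner_vec_scale_right cinner_vec_self intro!: add_pos_nonneg simp del: of_real_power)
  then show ?thesis
    unfolding q_positive_inv_iff[OF clinear_map_lyapunov bij_lyapunov[OF assms]] shift_lyapunov
    by (simp add: bij_lyapunov completely_positive_inv_lyapunov)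
qed

lemma accretive_if_real_part_ge_one:
  fixes Y :: "complex^'n^'n"
  assumes "Y + conj_transpose Y = mat 1 + R" "psd R"
  shows "accretive Y"
  unfolding accretive_def
proof (intro allI impI)
  fix v :: "complex^'n" assume "v \<noteq> 0"
  have "cinner_vec v ((Y + conj_transpose Y) *v v) = cinner_vec v ((mat 1 + R) *v v)"
    by (simp add: assms(1))
  then have "2 * Re (cinner_vec v (Y *v v)) = (norm v)\<^sup>2 + Re (cinner_vec v (R *v v))"
    by (simp add: matrix_vector_mult_add_rdistrib cinner_vec_add_right cinner_vec_conj_transpose
        cinner_vec_self complex_eq_iff del: of_real_power)
  moreover have "Re (cinner_vec v (R *v v)) \<ge> 0"
    using psdD[OF assms(2), of v] by (simp add: complex_nonneg_Reals_iff)
  ultimately show "0 < Re (cinner_vec v (Y *v v))"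
    using \<open>v \<noteq> 0\<close> by (smt (verit) zero_less_norm_iff zero_less_power)
qed

text \<open>
  The inverse of \<open>L\<^sub>Y\<close>, with \<open>Y\<close> from \<open>lyapunov_dominates_generator\<close>, is a nonzero \<open>q\<close>-subordinate, hence a
  resolvent of \<open>\<phi>\<close>; the normalisation of \<open>Y\<close> shows that it is \<open>\<phi>\<close> itself.
\<close>

theorem q_pure_imp_inverse_lyapunov:
  fixes \<phi> :: "complex^'n^'n \<Rightarrow> complex^'n^'n"
  assumes lin: "clinear_map \<phi>" and bij: "bij \<phi>" and pure: "q_pure \<phi>"
  shows "\<exists>Y. inv \<phi> = lyapunov Y \<and> Y + conj_transpose Y = mat 1"
proof -
  define \<psi> where "\<psi> = inv \<phi>"
  have lin\<psi>: "clinear_map \<psi>" and bij\<psi>: "bij \<psi>" and inv\<psi>: "inv \<psi> = \<phi>"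
    using lin bij by (simp_all add: \<psi>_def clinear_map_inv bij_imp_bij_inv inv_inv_eq)
  have q: "q_positive (inv \<psi>)" using pure by (simp add: inv\<psi> q_pure_def)
  have one: "\<psi> (mat 1) = mat 1"
    using pure inv_f_f[OF bij_is_inj[OF bij], of "mat 1"]
    by (simp add: \<psi>_def q_pure_def unital_def)
  \<comment> \<open>Any index can serve for the normalisation; \<open>undefined\<close> is an arbitrary one.\<close>
  obtain Y where cp: "completely_positive (\<lambda>A. lyapunov Y A - \<psi> A)"
    and zero: "choi (\<lambda>A. lyapunov Y A - \<psi> A) $ (undefined, undefined) $ (undefined, undefined) = 0"
    by (rule lyapunov_dominates_generator[OF lin\<psi> bij\<psi> q])
  have "psd (lyapunov Y (mat 1) - \<psi> (mat 1))"
    by (rule psd_completely_positive_one[OF cp])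
  then have acc: "accretive Y"
    by (intro accretive_if_real_part_ge_one[of Y "lyapunov Y (mat 1) - \<psi> (mat 1)"])
      (simp_all add: lyapunov_one one)
  note bijL = bij_lyapunov[OF acc]
  have "q_subordinate (inv (lyapunov Y)) (inv \<psi>)"
    by (rule q_subordinate_inv[OF lin\<psi> clinear_map_lyapunov bij\<psi> bijL q q_positive_inv_lyapunov[OF acc] cp])
  then have "inv (lyapunov Y) \<in> {\<lambda>_. 0} \<union> {resolvent s \<phi> | s. s \<ge> 0}"
    using pure unfolding q_pure_def inv\<psi> by blast
  moreover have "inv (lyapunov Y) \<noteq> (\<lambda>_. 0)"
  proof
    assume "inv (lyapunov Y) = (\<lambda>_. 0)"
    then have "lyapunov Y (inv (lyapunov Y) (mat 1)) = lyapunov Y 0" by simp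
    then have "(mat 1 :: complex^'n^'n) = 0"
      using bijL linear_0[OF clinear_map_imp_linear[OF clinear_map_lyapunov[of Y]]]
      by (simp add: bij_is_surj surj_f_inv_f)
    then show False by (simp add: vec_eq_iff mat_def split: if_splits)
  qed
  ultimately obtain s where s: "s \<ge> 0" "inv (lyapunov Y) = resolvent s (inv \<psi>)"
    by (auto simp: inv\<psi>)
  have b: "bij (shift s \<psi>)" by (rule bij_shift_if_q_positive_inv[OF bij\<psi> q s(1)])
  have "inv (inv (lyapunov Y)) = inv (inv (shift s \<psi>))"
    using s(2) resolvent_inv[OF bij\<psi> b] by simp
  then have eq: "lyapunov Y = shift s \<psi>" using b bijL by (simp add: inv_inv_eq)
  have "choi (\<lambda>A. lyapunov Y A - \<psi> A) = s *\<^sub>R choi (\<lambda>A. A)"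
    unfolding eq by (simp add: shift_def choi_scaleR)
  then have "s = 0"
    using zero by (simp add: choi_id outer_nth diagonal_vector_def)
  then have "\<psi> = lyapunov Y" using eq by (simp add: shift_0)
  with one show ?thesis by (auto simp: \<psi>_def[symmetric] lyapunov_one[symmetric])
qed

section \<open>Subordinates of inverse Lyapunov maps\<close>

text \<open>
  The maps \<open>T\<^sub>n = n \<theta>\<^sup>(\<^sup>n\<^sup>)\<close> lie below maps that converge to the identity, so a subsequence converges to
  a completely positive map below the identity, that is to some \<open>s \<cdot> id\<close>.  Letting \<open>n \<rightarrow> \<infinity>\<close> in
  \<open>T\<^sub>n B / n + T\<^sub>n (\<theta> B) = \<theta> B\<close> gives \<open>s \<theta> = \<theta>\<close>.  If \<open>s = 1\<close>, every \<open>A\<close> is a limit of the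
  vectors \<open>T\<^sub>n A\<close>, which lie in the range of \<open>\<theta>\<close>, a closed set.
\<close>

lemma q_subordinate_zero_or_bij:
  fixes \<psi> \<theta> :: "complex^'n^'n \<Rightarrow> complex^'n^'n"
  assumes lin: "clinear_map \<psi>" and bij: "bij \<psi>" and sub: "q_subordinate \<theta> (inv \<psi>)"
  shows "\<theta> = (\<lambda>_. 0) \<or> bij \<theta>"
proof -
  have q: "q_positive (inv \<psi>)" and q\<theta>: "q_positive \<theta>" using sub by (simp_all add: q_subordinate_def)
  have lin\<theta>: "clinear_map \<theta>" using q\<theta> by (simp add: q_positive_def)
  note lin\<theta>' = clinear_map_imp_linear[OF lin\<theta>]
  define T where "T n = (\<lambda>A. real n *\<^sub>R resolvent (real n) \<theta> A)" for n
  define F where "F n = (\<lambda>A. real n *\<^sub>R resolvent (real n) (inv \<psi>) A)" for n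
  define \<Omega> :: "complex^('n \<times> 'n)" where "\<Omega> = diagonal_vector"
  have b: "bij (shift t \<psi>)" if "t \<ge> 0" for t
    by (rule bij_shift_if_q_positive_inv[OF bij q that])
  have cpR: "completely_positive (resolvent t \<theta>)" if "t \<ge> 0" for t
    using q\<theta> that by (simp add: q_positive_def)
  have cpT: "completely_positive (T n)" for n
    unfolding T_def by (intro completely_positive_scaleR cpR) simp_all
  have linT: "clinear_map (T n)" for n by (rule completely_positive_clinear[OF cpT])
  have "completely_positive (\<lambda>A. F n A - T n A)" for n
    using completely_positive_scaleR[of "\<lambda>A. resolvent (real n) (inv \<psi>) A - resolvent (real n) \<theta> A" "real n"]
      sub by (simp add: q_subordinate_def F_def T_def scaleR_diff_right)
  from completely_positive_imp_psd_choi[OF this]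
  have dom: "psd (choi (F n) - choi (T n))" for n
    unfolding choi_diff .
  have "((\<lambda>n. F n A) \<longlongrightarrow> A) sequentially" for A
    using filterlim_compose[OF resolvent_first_order[OF lin b] filterlim_real_sequentially, of A]
    by (simp add: F_def resolvent_inv[OF bij b])
  then have limF: "((\<lambda>n. choi (F n)) \<longlongrightarrow> outer \<Omega>) sequentially"
    unfolding \<Omega>_def choi_id[symmetric] by (rule tendsto_choi)
  have psdT: "psd (choi (T n))" for n by (rule completely_positive_imp_psd_choi[OF cpT])
  have "bounded (range (\<lambda>n. choi (F n)))"
    using limF by (rule convergent_imp_bounded)
  then obtain K where K: "norm (choi (F n)) \<le> K" for n
    by (auto simp: bounded_iff)
  have "norm (choi (T n)) \<le> (real CARD('n \<times> 'n))\<^sup>2 * K" for n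
    by (rule order_trans[OF psd_norm_mono[OF psdT dom] mult_left_mono[OF K]]) simp
  then have "bounded (range (\<lambda>n. choi (T n)))"
    by (intro boundedI) auto
  from bounded_imp_convergent_subsequence[OF this]
  obtain L r where r: "strict_mono (r :: nat \<Rightarrow> nat)" and L: "((\<lambda>n. choi (T n)) \<circ> r) \<longlonglongrightarrow> L"
    by (elim exE conjE)
  have psdL: "psd L"
    by (rule psd_tendsto[OF L]) (simp_all add: psdT)
  have "((\<lambda>n. choi (F (r n)) - choi (T (r n))) \<longlongrightarrow> outer \<Omega> - L) sequentially"
    using LIMSEQ_subseq_LIMSEQ[OF limF r] L by (intro tendsto_diff) (simp_all add: comp_def)
  then have gap: "psd (outer \<Omega> - L)"
    by (rule psd_tendsto) (simp_all add: dom)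
  have "\<exists>s\<ge>0. L = s *\<^sub>R outer \<Omega>"
  proof (rule psd_rank_one[OF psdL])
    show "\<Omega> $ (undefined, undefined) = 1" by (simp add: \<Omega>_def diagonal_vector_def)
    show "Re (cinner_vec x (L *v x)) \<le> 0" if "cinner_vec \<Omega> x = 0" for x
      using psdD[OF gap, of x] that
      by (simp add: complex_nonneg_Reals_iff matrix_vector_mult_diff_left cinner_vec_diff_right
          quadratic_form_outer)
  qed
  then obtain s where s: "L = s *\<^sub>R outer \<Omega>" by blast
  have limT: "((\<lambda>n. T (r n) A) \<longlongrightarrow> s *\<^sub>R A) sequentially" for A
    by (rule tendsto_from_choi[where f = "\<lambda>n. T (r n)" and g = "\<lambda>A. s *\<^sub>R A"])
      (use linT L in \<open>simp_all add: clinear_map_scaleR_left clinear_map_id choi_scaleR choi_id comp_def s \<Omega>_def\<close>)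
  have limr: "filterlim (\<lambda>n. real (r n)) at_top sequentially"
    by (rule filterlim_compose[OF filterlim_real_sequentially filterlim_subseq[OF r]])
  have fix\<theta>: "s *\<^sub>R \<theta> B = \<theta> B" for B
  proof -
    have res: "resolvent t \<theta> B + t *\<^sub>R resolvent t \<theta> (\<theta> B) = \<theta> B" if "t \<ge> 0" for t
    proof -
      have linR: "clinear_map (resolvent t \<theta>)" by (rule completely_positive_clinear[OF cpR[OF that]])
      have "inv (\<lambda>A. A + t *\<^sub>R \<theta> A) (B + t *\<^sub>R \<theta> B) = B"
        using q_positive_bij[OF q\<theta> that] by (intro inv_f_eq) (simp_all add: bij_is_inj)
      then have "resolvent t \<theta> (B + t *\<^sub>R \<theta> B) = \<theta> B" by (simp add: resolvent_def)
      then show ?thesis by (simp add: clinear_map_add[OF linR] clinear_map_scaleR[OF linR])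
    qed
    have "((\<lambda>n. inverse (real (r n)) *\<^sub>R T (r n) B + T (r n) (\<theta> B)) \<longlongrightarrow> 0 *\<^sub>R (s *\<^sub>R B) + s *\<^sub>R \<theta> B) sequentially"
      by (intro tendsto_add tendsto_scaleR limT tendsto_inverse_0_at_top limr)
    moreover have "eventually (\<lambda>n. inverse (real (r n)) *\<^sub>R T (r n) B + T (r n) (\<theta> B) = \<theta> B) sequentially"
      using filterlim_at_top_dense[THEN iffD1, OF limr, rule_format, of 0]
    proof eventually_elim
      case (elim n)
      then show ?case using res[of "real (r n)"] by (simp add: T_def)
    qed
    ultimately have "((\<lambda>_ :: nat. \<theta> B) \<longlongrightarrow> 0 *\<^sub>R (s *\<^sub>R B) + s *\<^sub>R \<theta> B) sequentially"
      by (rule Lim_transform_eventually)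
    then show ?thesis by (simp add: tendsto_const_iff)
  qed
  show ?thesis
  proof (cases "\<theta> = (\<lambda>_. 0)")
    case False
    then obtain B where "\<theta> B \<noteq> 0" by auto
    then have s1: "s = 1" using fix\<theta>[of B] by (metis scaleR_cancel_right scaleR_one)
    have cl: "closed (range \<theta>)"
      by (intro closed_subspace linear_subspace_image lin\<theta>' subspace_UNIV)
    have "A \<in> range \<theta>" for A
    proof (rule Lim_in_closed_set[OF cl _ _ limT[of A, unfolded s1 scaleR_one]])
      have "T n A = \<theta> (real n *\<^sub>R inv (\<lambda>A. A + real n *\<^sub>R \<theta> A) A)" for n
        by (simp add: T_def resolvent_def clinear_map_scaleR[OF lin\<theta>])
      then show "eventually (\<lambda>n. T (r n) A \<in> range \<theta>) sequentially" by simp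
    qed simp
    then have "surj \<theta>" by blast
    then show ?thesis
      using linear_surjective_imp_injective[OF lin\<theta>'] by (simp add: bij_def)
  qed simp
qed

text \<open>
  With \<open>\<eta> = \<theta>\<^sup>-\<^sup>1\<close>, the second order expansion of the resolvents shows that \<open>\<eta> - L\<^sub>Y\<close> is completely
  positive.  On vectors orthogonal to \<open>\<Omega>\<close> its Choi form is that of \<open>\<eta>\<close>, which is nonpositive there.
  By \<open>psd_rank_one\<close> the difference is a multiple of the identity map.
\<close>

theorem q_subordinate_inv_lyapunov:
  fixes Y :: "complex^'n^'n"
  assumes bijL: "bij (lyapunov Y)" and sub: "q_subordinate \<theta> (inv (lyapunov Y))" and nz: "\<theta> \<noteq> (\<lambda>_. 0)"
  shows "\<exists>s\<ge>0. \<theta> = resolvent s (inv (lyapunov Y))"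
proof -
  let ?L = "lyapunov Y"
  define \<eta> where "\<eta> = inv \<theta>"
  define \<Omega> :: "complex^('n \<times> 'n)" where "\<Omega> = diagonal_vector"
  have bij\<theta>: "bij \<theta>"
    using q_subordinate_zero_or_bij[OF clinear_map_lyapunov bijL sub] nz by blast
  have qL: "q_positive (inv ?L)" and q\<theta>: "q_positive \<theta>" using sub by (simp_all add: q_subordinate_def)
  have lin\<theta>: "clinear_map \<theta>" using q\<theta> by (simp add: q_positive_def)
  have lin: "clinear_map \<eta>" and bij: "bij \<eta>" and inv: "inv \<eta> = \<theta>"
    using lin\<theta> bij\<theta> by (simp_all add: \<eta>_def clinear_map_inv bij_imp_bij_inv inv_inv_eq)
  have q: "q_positive (inv \<eta>)" using q\<theta> by (simp add: inv)
  define D where "D = choi \<eta> - choi ?L"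
  have "((\<lambda>t. (t\<^sup>2 *\<^sub>R choi (inv (shift t ?L)) - t *\<^sub>R outer \<Omega>) - (t\<^sup>2 *\<^sub>R choi (inv (shift t \<eta>)) - t *\<^sub>R outer \<Omega>))
      \<longlongrightarrow> - choi ?L - - choi \<eta>) at_top"
    unfolding \<Omega>_def
    by (intro tendsto_diff resolvent_choi_second_order clinear_map_lyapunov lin bijL bij qL q)
  then have lim: "((\<lambda>t. t\<^sup>2 *\<^sub>R (choi (inv (shift t ?L)) - choi (inv (shift t \<eta>)))) \<longlongrightarrow> D) at_top"
    by (simp add: D_def scaleR_diff_right)
  have psd_D: "psd D"
  proof (rule psd_tendsto[OF lim])
    have "psd (t\<^sup>2 *\<^sub>R (choi (inv (shift t ?L)) - choi (inv (shift t \<eta>))))" if t: "t \<ge> 0" for t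
    proof -
      have b: "bij (shift t ?L)" "bij (shift t \<eta>)"
        using bij_shift_if_q_positive_inv t bijL qL bij q by blast+
      have "completely_positive (\<lambda>A. resolvent t (inv ?L) A - resolvent t (inv \<eta>) A)"
        using sub t by (simp add: q_subordinate_def inv)
      then have "completely_positive (\<lambda>A. t\<^sup>2 *\<^sub>R (inv (shift t ?L) A - inv (shift t \<eta>) A))"
        unfolding resolvent_inv[OF bijL b(1)] resolvent_inv[OF bij b(2)]
        by (intro completely_positive_scaleR) simp_all
      from completely_positive_imp_psd_choi[OF this] show ?thesis
        by (simp add: choi_scaleR choi_diff)
    qed
    then show "eventually (\<lambda>t. psd (t\<^sup>2 *\<^sub>R (choi (inv (shift t ?L)) - choi (inv (shift t \<eta>))))) at_top"
      by (auto intro: eventually_mono[OF eventually_ge_at_top[of 0]])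
  qed simp
  have "\<exists>s\<ge>0. D = s *\<^sub>R outer \<Omega>"
  proof (rule psd_rank_one[OF psd_D])
    show "\<Omega> $ (undefined, undefined) = 1" by (simp add: \<Omega>_def diagonal_vector_def)
    fix x assume x: "cinner_vec \<Omega> x = 0"
    have "- choi \<eta> *v x = - (choi \<eta> *v x)"
      using matrix_vector_mult_diff_left[of 0 "choi \<eta>" x] by simp
    then have "Re (cinner_vec x (choi \<eta> *v x)) \<le> 0"
      using generator_conditionally_positive[OF lin bij q, of x] x cinner_vec_diff_right[of x 0 "choi \<eta> *v x"]
      by (simp add: \<Omega>_def complex_nonneg_Reals_iff)
    then show "Re (cinner_vec x (D *v x)) \<le> 0"
      using choi_lyapunov_conditionally_zero[of x Y] x
      by (simp add: D_def \<Omega>_def matrix_vector_mult_diff_left cinner_vec_diff_right)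
  qed
  then obtain s where s: "s \<ge> 0" "D = s *\<^sub>R outer \<Omega>" by blast
  have "choi \<eta> = choi (shift s ?L)"
  proof -
    have "choi (shift s ?L) = choi ?L + s *\<^sub>R outer \<Omega>"
      unfolding \<Omega>_def choi_id[symmetric] by (simp add: vec_eq_iff choi_nth shift_def)
    then show ?thesis using s(2) by (simp add: D_def algebra_simps)
  qed
  then have "\<eta> = shift s ?L"
    by (rule choi_injective[OF lin clinear_map_shift[OF clinear_map_lyapunov]])
  moreover have "bij (shift s ?L)" by (rule bij_shift_if_q_positive_inv[OF bijL qL s(1)])
  ultimately have "\<theta> = resolvent s (inv ?L)"
    using resolvent_inv[OF bijL, of s] inv by simp
  with s(1) show ?thesis by blast
qed

theorem q_pure_iff_inverse_lyapunov:
  fixes \<phi> :: "complex^'n^'n \<Rightarrow> complex^'n^'n"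
  assumes lin: "clinear_map \<phi>" and unit: "unital \<phi>" and bij: "bij \<phi>"
  shows "q_pure \<phi> \<longleftrightarrow> (\<exists>Y. inv \<phi> = lyapunov Y \<and> Y + conj_transpose Y = mat 1)"
proof
  assume "\<exists>Y. inv \<phi> = lyapunov Y \<and> Y + conj_transpose Y = mat 1"
  then obtain Y where Y: "inv \<phi> = lyapunov Y" "Y + conj_transpose Y = mat 1" by blast
  have acc: "accretive Y"
    by (rule accretive_if_real_part_ge_one[of Y 0]) (simp_all add: Y(2) psd_zero)
  have \<phi>: "\<phi> = inv (lyapunov Y)" using bij by (simp add: Y(1)[symmetric] inv_inv_eq)
  note bijL = bij_lyapunov[OF acc] and q = q_positive_inv_lyapunov[OF acc]
  have "{\<theta>. q_subordinate \<theta> \<phi>} = {\<lambda>_. 0} \<union> {resolvent s \<phi> | s. s \<ge> 0}"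
  proof (intro equalityI subsetI)
    fix \<theta> assume "\<theta> \<in> {\<theta>. q_subordinate \<theta> \<phi>}"
    then show "\<theta> \<in> {\<lambda>_. 0} \<union> {resolvent s \<phi> | s. s \<ge> 0}"
      using q_subordinate_inv_lyapunov[OF bijL, of \<theta>] unfolding \<phi> by blast
  next
    fix \<theta> assume "\<theta> \<in> {\<lambda>_. 0} \<union> {resolvent s \<phi> | s. s \<ge> 0}"
    then show "\<theta> \<in> {\<theta>. q_subordinate \<theta> \<phi>}"
      using q_subordinate_zero[OF q] q_subordinate_resolvent[OF clinear_map_lyapunov bijL q]
      unfolding \<phi> by blast
  qed
  then show "q_pure \<phi>" using q unit by (simp add: q_pure_def \<phi>)
qed (rule q_pure_imp_inverse_lyapunov[OF lin bij])

section \<open>Diagonalisation of Lyapunov maps\<close>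

lemma
  assumes "unitary U"
  shows unitary_cancel_right: "A ** conj_transpose U ** U = A" "A ** U ** conj_transpose U = A"
  using assms by (simp_all add: unitary_def flip: matrix_mul_assoc)

lemma lyapunov_unitary_conjugation:
  assumes "unitary U"
  shows "lyapunov (U ** D ** conj_transpose U) (U ** X ** conj_transpose U) = U ** lyapunov D X ** conj_transpose U"
  by (simp add: lyapunov_def conj_transpose_mult conj_transpose_conj_transpose matrix_mul_assoc
      unitary_cancel_right[OF assms] matrix_add_ldistrib matrix_matrix_mult_add_rdistrib)

lemma lyapunov_diagonal_matrix_unit:
  "lyapunov (diagonal d) (matrix_unit j k) = mscale (d j + cnj (d k)) (matrix_unit j k)"
proof -
  have "(diagonal d ** matrix_unit j k) $ p $ q = (\<Sum>r\<in>UNIV. if r = j then if p = j \<and> q = k then d j else 0 else 0)" for p q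
    unfolding matrix_matrix_mult_def vec_lambda_beta matrix_unit_nth by (rule sum.cong) (auto simp: diagonal_def)
  moreover have "(matrix_unit j k ** conj_transpose (diagonal d)) $ p $ q =
      (\<Sum>r\<in>UNIV. if r = k then if p = j \<and> q = k then cnj (d k) else 0 else 0)" for p q
    unfolding matrix_matrix_mult_def vec_lambda_beta matrix_unit_nth conj_transpose_nth
    by (rule sum.cong) (auto simp: diagonal_def)
  ultimately show ?thesis
    by (simp add: vec_eq_iff lyapunov_def mscale_nth matrix_unit_nth)
qed

lemma half_plus_imaginary_sum:
  "(1 / 2 + \<i> * of_real x) + cnj (1 / 2 + \<i> * of_real y) = 1 + \<i> * of_real (x - y)"
  by (simp add: complex_eq_iff)

lemma one_plus_imaginary_nonzero: "1 + \<i> * of_real x \<noteq> 0"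
  by (simp add: complex_eq_iff)

text \<open>
  The diagonal form of the matrices \<open>Y\<close> with \<open>Y + Y\<^sup>* = 1\<close>.
\<close>

definition half_plus_imaginary_diagonal :: "('m \<Rightarrow> real) \<Rightarrow> complex^'m^'m"
  where "half_plus_imaginary_diagonal l = diagonal (\<lambda>j. 1 / 2 + \<i> * of_real (l j))"

lemma half_plus_imaginary_diagonal_eq:
  "half_plus_imaginary_diagonal l = (1 / 2) *\<^sub>R mat 1 + mscale \<i> (diagonal (\<lambda>j. of_real (l j)))"
  by (simp add: vec_eq_iff half_plus_imaginary_diagonal_def diagonal_def mat_def mscale_nth
      scaleR_conv_of_real[where 'a = complex])

lemma lyapunov_half_plus_imaginary_matrix_unit:
  "lyapunov (half_plus_imaginary_diagonal l) (matrix_unit j k) =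
    mscale (1 + \<i> * of_real (l j - l k)) (matrix_unit j k)"
  unfolding half_plus_imaginary_diagonal_def lyapunov_diagonal_matrix_unit half_plus_imaginary_sum ..

lemma half_plus_imaginary_diagonal_real_part:
  "half_plus_imaginary_diagonal l + conj_transpose (half_plus_imaginary_diagonal l) = mat 1"
  by (simp add: vec_eq_iff half_plus_imaginary_diagonal_def diagonal_def mat_def conj_transpose_nth)

lemma mscale_mscale: "mscale a (mscale b A) = mscale (a * b) A"
  by (simp add: vec_eq_iff mscale_nth)

lemma mscale_1: "mscale 1 A = A"
  by (simp add: vec_eq_iff mscale_nth)

lemma diagonalise_half_plus_skew:
  fixes Y :: "complex^'n^'n"
  assumes Y: "Y + conj_transpose Y = mat 1"
  obtains U l where "unitary U" "Y = U ** half_plus_imaginary_diagonal l ** conj_transpose U"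
proof -
  define H where "H = mscale (- \<i>) (Y - (1 / 2) *\<^sub>R mat 1)"
  have "Y $ a $ b + cnj (Y $ b $ a) = mat 1 $ a $ b" for a b
    using arg_cong[OF Y, of "\<lambda>M. M $ a $ b"] by (simp add: conj_transpose_nth)
  then have Yab: "cnj (Y $ b $ a) = mat 1 $ a $ b - Y $ a $ b" for a b
    by (simp add: eq_diff_eq add.commute)
  have "hermitian H"
    by (simp add: hermitian_def vec_eq_iff H_def conj_transpose_nth mscale_nth Yab)
      (simp add: mat_def scaleR_conv_of_real[where 'a = complex] algebra_simps)
  then obtain U l where U: "unitary U" "H = U ** diagonal (\<lambda>i. of_real (l i)) ** conj_transpose U"
    by (rule spectral_theorem)
  have "Y = (1 / 2) *\<^sub>R mat 1 + mscale \<i> H"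
    by (simp add: H_def mscale_mscale mscale_1)
  also have "\<dots> = U ** half_plus_imaginary_diagonal l ** conj_transpose U"
    using U(1) by (simp add: half_plus_imaginary_diagonal_eq U(2) matrix_add_ldistrib
        matrix_matrix_mult_add_rdistrib mscale_mult unitary_def flip: mscale_of_real)
  finally show thesis using that U(1) by blast
qed

lemma unitary_conjugate_matrix_unit:
  assumes lin: "clinear_map \<phi>" and bij: "bij \<phi>" and U: "unitary U"
    and inv: "inv \<phi> = lyapunov (U ** half_plus_imaginary_diagonal l ** conj_transpose U)"
  shows "unitary_conjugate U \<phi> (mscale a (matrix_unit j k)) =
    mscale (a / (1 + \<i> * of_real (l j - l k))) (matrix_unit j k)"
proof -
  define m where "m = 1 + \<i> * of_real (l j - l k)"
  have m: "m \<noteq> 0" unfolding m_def by (rule one_plus_imaginary_nonzero)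
  let ?E = "U ** matrix_unit j k ** conj_transpose U"
  have "inv \<phi> ?E = mscale m ?E"
    unfolding inv lyapunov_unitary_conjugation[OF U] lyapunov_half_plus_imaginary_matrix_unit m_def
    by (simp add: mscale_mult)
  then have "\<phi> (inv \<phi> ?E) = mscale m (\<phi> ?E)" by (simp add: clinear_map_mscale[OF lin])
  then have "?E = mscale m (\<phi> ?E)" using bij by (simp add: bij_is_surj surj_f_inv_f)
  then have "mscale (a / m) ?E = mscale (a / m) (mscale m (\<phi> ?E))" by simp
  then have "\<phi> (mscale a ?E) = mscale (a / m) ?E"
    using m by (simp add: mscale_mscale clinear_map_mscale[OF lin])
  then have "unitary_conjugate U \<phi> (mscale a (matrix_unit j k)) =
      conj_transpose U ** mscale (a / m) ?E ** U"
    by (simp add: unitary_conjugate_def mscale_mult)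
  also have "\<dots> = mscale (a / m) (conj_transpose U ** U ** matrix_unit j k ** conj_transpose U ** U)"
    by (simp add: mscale_mult matrix_mul_assoc)
  also have "\<dots> = mscale (a / m) (matrix_unit j k)"
    using U by (simp add: unitary_cancel_right[OF U] unitary_def)
  finally show ?thesis by (simp add: m_def)
qed

text \<open>
  The candidate inverse and \<open>\<phi>\<close> are both diagonal in the matrix units of the basis given by \<open>U\<close>, with
  reciprocal eigenvalues, so their composition fixes every matrix unit.
\<close>

lemma inverse_lyapunov_if_schur:
  assumes lin: "clinear_map \<phi>" and bij: "bij \<phi>" and U: "unitary U"
    and schur: "\<And>j k. unitary_conjugate U \<phi> (matrix_unit j k) =
      mscale (1 / (1 + \<i> * of_real (l j - l k))) (matrix_unit j k)"
  shows "inv \<phi> = lyapunov (U ** half_plus_imaginary_diagonal l ** conj_transpose U)"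
proof -
  let ?Y = "U ** half_plus_imaginary_diagonal l ** conj_transpose U"
  have linU: "clinear_map (\<lambda>A. V ** A ** W)" for V W
    by (simp add: clinear_map_iff matrix_add_ldistrib matrix_matrix_mult_add_rdistrib mscale_mult)
  have \<phi>U: "\<phi> (U ** A ** conj_transpose U) = U ** unitary_conjugate U \<phi> A ** conj_transpose U" for A
  proof -
    have "U ** unitary_conjugate U \<phi> A ** conj_transpose U =
        U ** conj_transpose U ** \<phi> (U ** A ** conj_transpose U) ** U ** conj_transpose U"
      by (simp add: unitary_conjugate_def matrix_mul_assoc)
    then show ?thesis using U by (simp add: unitary_cancel_right[OF U] unitary_def)
  qed
  define \<Psi> where "\<Psi> A = lyapunov (half_plus_imaginary_diagonal l) (unitary_conjugate U \<phi> A)" for A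
  have "clinear_map \<Psi>"
    unfolding \<Psi>_def unitary_conjugate_def
    by (intro clinear_map_compose[OF clinear_map_lyapunov] clinear_map_compose[OF linU]
        clinear_map_compose[OF lin] linU)
  moreover have "\<Psi> (matrix_unit j k) = matrix_unit j k" for j k
    using one_plus_imaginary_nonzero[of "l j - l k"]
    by (simp add: \<Psi>_def schur clinear_map_mscale[OF clinear_map_lyapunov]
        lyapunov_half_plus_imaginary_matrix_unit mscale_mscale mscale_1)
  then have "choi \<Psi> = choi (\<lambda>A. A)" by (simp add: vec_eq_iff choi_nth)
  ultimately have \<Psi>: "\<Psi> = (\<lambda>A. A)" using choi_injective clinear_map_id by blast
  have "lyapunov ?Y (\<phi> B) = B" for B
  proof -
    have B: "B = U ** (conj_transpose U ** B ** U) ** conj_transpose U" (is "_ = U ** ?A ** _")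
      using U by (simp add: matrix_mul_assoc unitary_cancel_right[OF U] unitary_def)
    have "lyapunov ?Y (\<phi> (U ** ?A ** conj_transpose U)) = U ** \<Psi> ?A ** conj_transpose U"
      unfolding \<phi>U lyapunov_unitary_conjugation[OF U] \<Psi>_def ..
    then show ?thesis unfolding \<Psi> using B by simp
  qed
  then have "lyapunov ?Y (\<phi> (inv \<phi> A)) = inv \<phi> A" for A .
  then show ?thesis using bij by (simp add: fun_eq_iff bij_is_surj surj_f_inv_f)
qed

theorem theorem6p11:
  fixes \<phi> :: "complex^'n^'n \<Rightarrow> complex^'n^'n"
  assumes "clinear_map \<phi>" and "unital \<phi>" and "bij \<phi>"
  shows "q_pure \<phi> \<longleftrightarrow>
    (\<exists>(U :: complex^'n^'n) (l :: 'n \<Rightarrow> real).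
      unitary U \<and> (\<Sum>j\<in>UNIV. l j) = 0 \<and>
      (\<forall>(A :: complex^'n^'n) j k.
        unitary_conjugate U \<phi> (mscale (A $ j $ k) (matrix_unit j k)) =
        mscale (A $ j $ k / (1 + \<i> * of_real (l j - l k))) (matrix_unit j k)))"
proof
  assume "q_pure \<phi>"
  then obtain Y where Y: "inv \<phi> = lyapunov Y" "Y + conj_transpose Y = mat 1"
    using q_pure_iff_inverse_lyapunov[OF assms] by blast
  obtain U h where U: "unitary U" and YU: "Y = U ** half_plus_imaginary_diagonal h ** conj_transpose U"
    by (rule diagonalise_half_plus_skew[OF Y(2)])
  \<comment> \<open>Subtracting the mean makes the sum zero and leaves all differences unchanged.\<close>
  define l where "l j = h j - (\<Sum>i\<in>UNIV. h i) / of_nat CARD('n)" for j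
  have "(\<Sum>j\<in>UNIV. l j) = 0" by (simp add: l_def sum_subtractf)
  moreover have "unitary_conjugate U \<phi> (mscale a (matrix_unit j k)) =
      mscale (a / (1 + \<i> * of_real (l j - l k))) (matrix_unit j k)" for a j k
  proof -
    have "l j - l k = h j - h k" by (simp add: l_def)
    then show ?thesis
      using unitary_conjugate_matrix_unit[OF assms(1,3) U Y(1)[unfolded YU]] by simp
  qed
  ultimately show "\<exists>(U :: complex^'n^'n) (l :: 'n \<Rightarrow> real).
      unitary U \<and> (\<Sum>j\<in>UNIV. l j) = 0 \<and>
      (\<forall>(A :: complex^'n^'n) j k.
        unitary_conjugate U \<phi> (mscale (A $ j $ k) (matrix_unit j k)) =
        mscale (A $ j $ k / (1 + \<i> * of_real (l j - l k))) (matrix_unit j k))"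
    using U by blast
next
  assume "\<exists>(U :: complex^'n^'n) (l :: 'n \<Rightarrow> real).
      unitary U \<and> (\<Sum>j\<in>UNIV. l j) = 0 \<and>
      (\<forall>(A :: complex^'n^'n) j k.
        unitary_conjugate U \<phi> (mscale (A $ j $ k) (matrix_unit j k)) =
        mscale (A $ j $ k / (1 + \<i> * of_real (l j - l k))) (matrix_unit j k))"
  then obtain U :: "complex^'n^'n" and l :: "'n \<Rightarrow> real" where U: "unitary U"
    and schur: "\<And>(A :: complex^'n^'n) j k.
      unitary_conjugate U \<phi> (mscale (A $ j $ k) (matrix_unit j k)) =
      mscale (A $ j $ k / (1 + \<i> * of_real (l j - l k))) (matrix_unit j k)"
    by blast
  let ?D = "half_plus_imaginary_diagonal l"
  let ?Y = "U ** ?D ** conj_transpose U"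
  have "inv \<phi> = lyapunov ?Y"
  proof (rule inverse_lyapunov_if_schur[OF assms(1,3) U])
    show "unitary_conjugate U \<phi> (matrix_unit j k) =
        mscale (1 / (1 + \<i> * of_real (l j - l k))) (matrix_unit j k)" for j k
      using schur[of "matrix_unit j k" j k] by (simp add: matrix_unit_nth mscale_1)
  qed
  moreover have "?Y + conj_transpose ?Y = mat 1"
  proof -
    have "?Y + conj_transpose ?Y = U ** (?D + conj_transpose ?D) ** conj_transpose U"
      by (simp add: conj_transpose_mult conj_transpose_conj_transpose matrix_mul_assoc
          matrix_add_ldistrib matrix_matrix_mult_add_rdistrib)
    then show ?thesis using U by (simp add: half_plus_imaginary_diagonal_real_part unitary_def)
  qed
  ultimately show "q_pure \<phi>" using q_pure_iff_inverse_lyapunov[OF assms] by blast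
qed

end
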